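(* Let $f\in C(\Omega\cup\Gamma_N)$ be bounded and $g\in C(\Gamma_D)$. Then there exist $\underline u,\overline u\in C(\bar\Omega)$, each a viscosity solution of $$-\Delta_\infty u-\beta|Du|=f\text{ in }\Omega,\qquad D_\nu u=0\text{ on }\Gamma_N,\qquad u=g\text{ on }\Gamma_D,$$ such that: if $u\in USC(\bar\Omega)$ is a viscosity subsolution of the system ($-\Delta_\infty u-\beta|Du|\le f$ in $\Omega$, $D_\nu u\le 0$ on $\Gamma_N$) with $u\le g$ on $\Gamma_D$, then $u\le\overline u$; and if $u\in LSC(\bar\Omega)$ is a viscosity supersolution of the system ($-\Delta_\infty u-\beta|Du|\ge f$ in $\Omega$, $D_\nu u\ge 0$ on $\Gamma_N$) with $u\ge g$ on $\Gamma_D$, then $u\ge\underline u$.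
   Context: Standing setting: $\Omega\subseteq\mathbb{R}^n$ is a bounded, open, connected set with $C^1$ boundary; $\nu$ is the outward unit normal. For some open $A\subseteq\mathbb{R}^n$, $\Gamma_N:=\partial\Omega\cap A$, $\Gamma_D:=\partial\Omega\setminus A\neq\emptyset$. If $\Gamma_N\ne\emptyset$, $\Omega$ is convex. $\beta\in\mathbb{R}$. For $\varphi\in C^2$: $\Delta_\infty^+\varphi(x):=|D\varphi|^{-2}\langle D^2\varphi D\varphi,D\varphi\rangle(x)$ if $D\varphi(x)\ne0$, else $\max_{|v|=1}\langle D^2\varphi(x)v,v\rangle$; $\Delta^-_\infty\varphi:=-\Delta^+_\infty(-\varphi)$. Subsolution: $u$ USC such that for every $\varphi\in C^2(\bar\Omega)$ and $x_0\in\Omega\cup\Gamma_N$ where $u-\varphi$ has a local maximum relative to $\bar\Omega$: $-\Delta^+_\infty\varphi(x_0)-\beta|D\varphi(x_0)|\le f(x_0)$, or $x_0\in\Gamma_N$ and $D\varphi(x_0)\cdot\nu(x_0)\le0$. Supersolution: $v$ LSC such that for every $\varphi\in C^2(\bar\Omega)$ and $x_0\in\Omega\cup\Gamma_N$ where $v-\varphi$ has a local minimum relative to $\bar\Omega$: $-\Delta^-_\infty\varphi(x_0)-\beta|D\varphi(x_0)|\ge f(x_0)$, or $x_0\in\Gamma_N$ and $D\varphi(x_0)\cdot\nu(x_0)\ge0$. A viscosity solution of the system is a continuous function that is both; a solution of the boundary-value problem is additionally equal to $g$ on $\Gamma_D$. *)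

theory Defs
  imports "HOL-Analysis.Analysis"
begin

definition usc_on :: "'a::metric_space set \<Rightarrow> ('a \<Rightarrow> real) \<Rightarrow> bool" where
  "usc_on S u \<longleftrightarrow> (\<forall>x\<in>S. \<forall>e>0. \<exists>d>0. \<forall>y\<in>S. dist y x < d \<longrightarrow> u y < u x + e)"

definition lsc_on :: "'a::metric_space set \<Rightarrow> ('a \<Rightarrow> real) \<Rightarrow> bool" where
  "lsc_on S u \<longleftrightarrow> (\<forall>x\<in>S. \<forall>e>0. \<exists>d>0. \<forall>y\<in>S. dist y x < d \<longrightarrow> u x - e < u y)"

definition C1_grad_on :: "'a::euclidean_space set \<Rightarrow> ('a \<Rightarrow> real) \<Rightarrow> ('a \<Rightarrow> 'a) \<Rightarrow> bool" where
  "C1_grad_on U rho Drho \<longleftrightarrow>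
     (\<forall>x\<in>U. (rho has_derivative (\<lambda>h. Drho x \<bullet> h)) (at x)) \<and> continuous_on U Drho"

definition C2_with :: "('a::euclidean_space \<Rightarrow> real) \<Rightarrow> ('a \<Rightarrow> 'a) \<Rightarrow> ('a \<Rightarrow> 'a \<Rightarrow> 'a) \<Rightarrow> bool" where
  "C2_with phi Dphi Hphi \<longleftrightarrow>
     (\<forall>x. (phi has_derivative (\<lambda>h. Dphi x \<bullet> h)) (at x)) \<and>
     (\<forall>x. (Dphi has_derivative Hphi x) (at x)) \<and>
     (\<forall>v. continuous_on UNIV (\<lambda>x. Hphi x v))"

definition C1_domain_normal :: "'a::euclidean_space set \<Rightarrow> ('a \<Rightarrow> 'a) \<Rightarrow> bool" where
  "C1_domain_normal \<Omega> \<nu> \<longleftrightarrow>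
     (\<forall>p\<in>frontier \<Omega>. \<exists>U rho Drho. open U \<and> p \<in> U \<and> C1_grad_on U rho Drho \<and>
        (\<forall>x\<in>U. Drho x \<noteq> 0) \<and> \<Omega> \<inter> U = {x\<in>U. rho x < 0} \<and>
        \<nu> p = Drho p /\<^sub>R norm (Drho p))"

text \<open>Infinity Laplacians Delta^+_infty, Delta^-_infty at a point, given the gradient d and
  the Hessian H (as a linear map) of the test function at that point.\<close>
definition inf_lap_plus :: "'a::euclidean_space \<Rightarrow> ('a \<Rightarrow> 'a) \<Rightarrow> real" where
  "inf_lap_plus d H =
     (if d \<noteq> 0 then (H d \<bullet> d) / (norm d)\<^sup>2
      else Sup {H v \<bullet> v | v. norm v = 1})"

definition inf_lap_minus :: "'a::euclidean_space \<Rightarrow> ('a \<Rightarrow> 'a) \<Rightarrow> real" where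
  "inf_lap_minus d H = - inf_lap_plus (- d) (\<lambda>v. - H v)"

definition loc_max_rel :: "'a::metric_space set \<Rightarrow> ('a \<Rightarrow> real) \<Rightarrow> 'a \<Rightarrow> bool" where
  "loc_max_rel S w x0 \<longleftrightarrow> (\<exists>r>0. \<forall>x\<in>S \<inter> ball x0 r. w x \<le> w x0)"

definition loc_min_rel :: "'a::metric_space set \<Rightarrow> ('a \<Rightarrow> real) \<Rightarrow> 'a \<Rightarrow> bool" where
  "loc_min_rel S w x0 \<longleftrightarrow> (\<exists>r>0. \<forall>x\<in>S \<inter> ball x0 r. w x0 \<le> w x)"

definition visc_sub ::
  "'a::euclidean_space set \<Rightarrow> 'a set \<Rightarrow> ('a \<Rightarrow> 'a) \<Rightarrow> real \<Rightarrow> ('a \<Rightarrow> real) \<Rightarrow> ('a \<Rightarrow> real) \<Rightarrow> bool" where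
  "visc_sub \<Omega> \<Gamma>N \<nu> \<beta> f u \<longleftrightarrow> usc_on (closure \<Omega>) u \<and>
     (\<forall>phi Dphi Hphi x0. C2_with phi Dphi Hphi \<longrightarrow> x0 \<in> \<Omega> \<union> \<Gamma>N \<longrightarrow>
        loc_max_rel (closure \<Omega>) (\<lambda>x. u x - phi x) x0 \<longrightarrow>
        (- inf_lap_plus (Dphi x0) (Hphi x0) - \<beta> * norm (Dphi x0) \<le> f x0 \<or>
         (x0 \<in> \<Gamma>N \<and> Dphi x0 \<bullet> \<nu> x0 \<le> 0)))"

definition visc_super ::
  "'a::euclidean_space set \<Rightarrow> 'a set \<Rightarrow> ('a \<Rightarrow> 'a) \<Rightarrow> real \<Rightarrow> ('a \<Rightarrow> real) \<Rightarrow> ('a \<Rightarrow> real) \<Rightarrow> bool" where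
  "visc_super \<Omega> \<Gamma>N \<nu> \<beta> f v \<longleftrightarrow> lsc_on (closure \<Omega>) v \<and>
     (\<forall>phi Dphi Hphi x0. C2_with phi Dphi Hphi \<longrightarrow> x0 \<in> \<Omega> \<union> \<Gamma>N \<longrightarrow>
        loc_min_rel (closure \<Omega>) (\<lambda>x. v x - phi x) x0 \<longrightarrow>
        (- inf_lap_minus (Dphi x0) (Hphi x0) - \<beta> * norm (Dphi x0) \<ge> f x0 \<or>
         (x0 \<in> \<Gamma>N \<and> Dphi x0 \<bullet> \<nu> x0 \<ge> 0)))"

definition visc_sol_bvp ::
  "'a::euclidean_space set \<Rightarrow> 'a set \<Rightarrow> 'a set \<Rightarrow> ('a \<Rightarrow> 'a) \<Rightarrow> real \<Rightarrow> ('a \<Rightarrow> real) \<Rightarrow> ('a \<Rightarrow> real)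
     \<Rightarrow> ('a \<Rightarrow> real) \<Rightarrow> bool" where
  "visc_sol_bvp \<Omega> \<Gamma>N \<Gamma>D \<nu> \<beta> f g u \<longleftrightarrow> continuous_on (closure \<Omega>) u \<and>
     visc_sub \<Omega> \<Gamma>N \<nu> \<beta> f u \<and> visc_super \<Omega> \<Gamma>N \<nu> \<beta> f u \<and> (\<forall>x\<in>\<Gamma>D. u x = g x)"

end

theory Submission
  imports Defs
begin

text \<open>The greatest solution is Perron's supremum of all subsolutions below g on the Dirichlet
  boundary. No comparison principle holds, so continuity of the supremum has to come from the
  equation: if G is increasing with G'' + |\<beta>| G' below - sup |f|, then G(|x - y|) is a strict
  supersolution away from y, and convexity makes its normal derivative positive on the Neumann
  boundary. Hence a subsolution lies below u(y) + G(|x - y|) as soon as it does so on the Dirichlet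
  boundary. With G steep enough this bounds all subsolutions locally Lipschitz-uniformly away from
  the Dirichlet boundary, and together with the subsolutions B - G(|x - y|) it gives barriers there.
  The least solution is obtained from the symmetry u, f, g, \<beta> to -u, -f, -g, -\<beta>.\<close>

section \<open>Second-order jets\<close>

text \<open>The cones G(|x - y|) are not smooth at the vertex y, so they are not C2 test functions
  on the whole space. The viscosity conditions are therefore restated through one-sided second-order
  expansions, which see only a neighbourhood of the point. Convexity acts through the sign of the
  scalar product of x - y with \<nu> x at Neumann points x: strict for y in \<Omega>, which excludes
  a Neumann maximum under an upright cone; weak for y in the closure, which suffices to make an
  inverted cone with Dirichlet vertex a subsolution. One G serves both kinds of cone because its
  inequality carries |\<beta>|: the term \<beta>|Du| keeps its sign when the cone is turned over,
  while the second-order term changes it. Cone bounds pass to the supremum, so it is continuous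
  before any equation is known for it, and Perron's argument works with the supremum itself in place
  of its semicontinuous envelopes.\<close>

text \<open>H is not required to be symmetric: only its quadratic form enters.\<close>

definition taylor2 :: "('a::euclidean_space \<Rightarrow> real) \<Rightarrow> 'a \<Rightarrow> 'a \<Rightarrow> ('a \<Rightarrow> 'a) \<Rightarrow> bool" where
  "taylor2 \<phi> x p H \<longleftrightarrow> linear H \<and> (\<forall>e>0. \<exists>r>0. \<forall>y\<in>ball x r.
     \<bar>\<phi> y - \<phi> x - p \<bullet> (y - x) - H (y - x) \<bullet> (y - x) / 2\<bar> \<le> e * (norm (y - x))\<^sup>2)"

definition superjet :: "'a::euclidean_space set \<Rightarrow> ('a \<Rightarrow> real) \<Rightarrow> 'a \<Rightarrow> 'a \<Rightarrow> ('a \<Rightarrow> 'a) \<Rightarrow> bool" where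
  "superjet S u x p H \<longleftrightarrow> linear H \<and> (\<forall>e>0. \<exists>r>0. \<forall>y\<in>S \<inter> ball x r.
     u y \<le> u x + p \<bullet> (y - x) + H (y - x) \<bullet> (y - x) / 2 + e * (norm (y - x))\<^sup>2)"

text \<open>The mean value theorem along the segment from \<open>x\<close> to \<open>y\<close>
  reduces the remainder to the linearisation error of the gradient at \<open>x\<close>. The
  smoothness hypotheses are local, so a cone qualifies at every point other than its vertex.\<close>

lemma taylor2I:
  fixes \<phi> :: "'a::euclidean_space \<Rightarrow> real"
  assumes r: "r > 0" and d1: "\<And>y. y \<in> ball x r \<Longrightarrow> (\<phi> has_derivative (\<lambda>h. D y \<bullet> h)) (at y)"
    and d2: "(D has_derivative H) (at x)"
  shows "taylor2 \<phi> x (D x) H"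
  unfolding taylor2_def
proof (intro conjI allI impI)
  show lin: "linear H" using d2 has_derivative_linear by blast
  fix e :: real assume e: "e > 0"
  obtain s where s: "s > 0"
    and sD: "\<And>y. norm (y - x) < s \<Longrightarrow> norm (D y - D x - H (y - x)) \<le> e * norm (y - x)"
    using d2 e unfolding has_derivative_at_alt by meson
  have "\<bar>\<phi> y - \<phi> x - D x \<bullet> (y - x) - H (y - x) \<bullet> (y - x) / 2\<bar> \<le> e * (norm (y - x))\<^sup>2"
    if y: "y \<in> ball x (min r s)" for y
  proof -
    define h where "h = y - x"
    \<comment> \<open>\<open>k\<close> is \<phi> on the segment minus its first- and second-order
      Taylor terms, so \<open>k 1 - k 0\<close> is exactly the remainder to be bounded.\<close>
    define k where "k t = \<phi> (x + t *\<^sub>R h) - t * (D x \<bullet> h) - t\<^sup>2 * (H h \<bullet> h) / 2" for t :: real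
    define k' where "k' t = (D (x + t *\<^sub>R h) - D x - H (t *\<^sub>R h)) \<bullet> h" for t :: real
    have nh: "norm h < min r s" using y by (simp add: h_def dist_norm norm_minus_commute)
    have th: "norm (t *\<^sub>R h) < min r s \<and> norm (t *\<^sub>R h) \<le> norm h" if "0 \<le> t" "t \<le> 1" for t :: real
    proof -
      have "norm (t *\<^sub>R h) \<le> norm h" using that by (simp add: mult_left_le_one_le)
      then show ?thesis using nh by linarith
    qed
    have der: "(k has_real_derivative k' t) (at t)" if t: "0 \<le> t" "t \<le> 1" for t
    proof -
      have "x + t *\<^sub>R h \<in> ball x r" using th[OF t] by (simp add: dist_norm)
      then have 1: "(\<phi> has_derivative (\<lambda>v. D (x + t *\<^sub>R h) \<bullet> v)) (at (x + t *\<^sub>R h))" by (rule d1)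
      have 2: "((\<lambda>t. x + t *\<^sub>R h) has_derivative (\<lambda>s. s *\<^sub>R h)) (at t)"
        by (auto intro!: derivative_eq_intros)
      have 3: "((\<lambda>t. \<phi> (x + t *\<^sub>R h)) has_derivative (\<lambda>s. D (x + t *\<^sub>R h) \<bullet> (s *\<^sub>R h))) (at t)"
        using has_derivative_compose[OF 2 1] .
      then have "((\<lambda>t. \<phi> (x + t *\<^sub>R h)) has_real_derivative (D (x + t *\<^sub>R h) \<bullet> h)) (at t)"
        by (simp add: has_field_derivative_def mult.commute[of _ "D (x + t *\<^sub>R h) \<bullet> h"])
      then show ?thesis unfolding k_def k'_def
        by (auto intro!: derivative_eq_intros simp: inner_diff_left linear_cmul[OF lin])
    qed
    obtain z :: real where z: "0 < z" "z < 1" and kz: "k 1 - k 0 = (1 - 0) * k' z"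
      using MVT2[of 0 1 k k'] der by auto
    have "\<bar>k' z\<bar> \<le> norm (D (x + z *\<^sub>R h) - D x - H (z *\<^sub>R h)) * norm h"
      unfolding k'_def by (rule Cauchy_Schwarz_ineq2)
    also have "\<dots> \<le> (e * norm (z *\<^sub>R h)) * norm h"
      using sD[of "x + z *\<^sub>R h"] th[of z] z by (intro mult_right_mono) auto
    also have "\<dots> \<le> (e * norm h) * norm h"
      using th[of z] z e by (intro mult_right_mono mult_left_mono) auto
    finally have "\<bar>k' z\<bar> \<le> e * (norm h)\<^sup>2" by (simp add: power2_eq_square)
    moreover have "k 1 - k 0 = \<phi> y - \<phi> x - D x \<bullet> h - (H h \<bullet> h) / 2" by (simp add: k_def h_def)
    ultimately show ?thesis using kz by (simp add: h_def)
  qed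
  then show "\<exists>r>0. \<forall>y\<in>ball x r. \<bar>\<phi> y - \<phi> x - D x \<bullet> (y - x) - H (y - x) \<bullet> (y - x) / 2\<bar> \<le> e * (norm (y - x))\<^sup>2"
    using r s by (intro exI[of _ "min r s"]) auto
qed

text \<open>Re-expanding a quadratic at another base point is exact; symmetry merges the two cross
  terms into the new gradient \<open>p + H (x - x0)\<close>.\<close>

lemma taylor2_quadratic:
  assumes "linear H" and sym: "\<And>v w. H v \<bullet> w = v \<bullet> H w"
  shows "taylor2 (\<lambda>y. c + p \<bullet> (y - x0) + H (y - x0) \<bullet> (y - x0) / 2) x (p + H (x - x0)) H"
proof -
  have E: "c + p \<bullet> (y - x0) + H (y - x0) \<bullet> (y - x0) / 2 - (c + p \<bullet> (x - x0) + H (x - x0) \<bullet> (x - x0) / 2)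
      - (p + H (x - x0)) \<bullet> (y - x) - H (y - x) \<bullet> (y - x) / 2 = 0" (is "?E y = 0") for y
  proof -
    define a where "a = y - x" define b where "b = x - x0"
    have 1: "y - x0 = a + b" "y - x = a" "x - x0 = b" by (simp_all add: a_def b_def)
    have "H a \<bullet> b = H b \<bullet> a" using sym[of a b] by (simp add: inner_commute)
    then show ?thesis
      unfolding 1 by (simp add: linear_add[OF assms(1)] inner_add_left inner_add_right field_simps)
  qed
  have "\<bar>?E y\<bar> \<le> e * (norm (y - x))\<^sup>2" if "e > 0" for e y unfolding E using that by simp
  then show ?thesis
    using assms(1) unfolding taylor2_def by (blast intro: zero_less_one)
qed

lemma taylor2_uminus: "taylor2 \<phi> x p H \<Longrightarrow> taylor2 (\<lambda>y. c - \<phi> y) x (- p) (\<lambda>v. - H v)"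
proof -
  assume a: "taylor2 \<phi> x p H"
  have "\<bar>(c - \<phi> y) - (c - \<phi> x) - (- p) \<bullet> (y - x) - (- H (y - x)) \<bullet> (y - x) / 2\<bar>
     = \<bar>\<phi> y - \<phi> x - p \<bullet> (y - x) - H (y - x) \<bullet> (y - x) / 2\<bar>" for y
    by (simp add: abs_if)
  moreover have "linear (\<lambda>v. - H v)" using a by (simp add: taylor2_def linear_compose_neg)
  ultimately show ?thesis using a unfolding taylor2_def by simp
qed

lemma superjet_of_loc_max:
  assumes "loc_max_rel S (\<lambda>x. u x - \<phi> x) x" and "taylor2 \<phi> x p H"
  shows "superjet S u x p H"
  unfolding superjet_def
proof (intro conjI allI impI)
  show "linear H" using assms(2) by (simp add: taylor2_def)
  fix e :: real assume "e > 0"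
  then obtain r where r: "r > 0" "\<forall>y\<in>ball x r.
     \<bar>\<phi> y - \<phi> x - p \<bullet> (y - x) - H (y - x) \<bullet> (y - x) / 2\<bar> \<le> e * (norm (y - x))\<^sup>2"
    using assms(2) unfolding taylor2_def by meson
  obtain s where s: "s > 0" "\<forall>y\<in>S \<inter> ball x s. u y - \<phi> y \<le> u x - \<phi> x"
    using assms(1) unfolding loc_max_rel_def by meson
  have "u y \<le> u x + p \<bullet> (y - x) + H (y - x) \<bullet> (y - x) / 2 + e * (norm (y - x))\<^sup>2"
    if "y \<in> S \<inter> ball x (min r s)" for y
    using that r(2)[rule_format, of y] s(2)[rule_format, of y] by (auto simp: abs_le_iff)
  then show "\<exists>r>0. \<forall>y\<in>S \<inter> ball x r. u y \<le> u x + p \<bullet> (y - x) + H (y - x) \<bullet> (y - x) / 2 + e * (norm (y - x))\<^sup>2"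
    using r(1) s(1) by (intro exI[of _ "min r s"]) auto
qed

text \<open>A bound from above is inherited by any smaller function touching at \<open>x\<close>.
  This is how a maximum or a glued function passes its jets on to whichever piece is active.\<close>

lemma superjet_antimono:
  assumes "superjet S w x p H" and "w x = u x" and "r > 0" and "\<And>y. y \<in> S \<inter> ball x r \<Longrightarrow> u y \<le> w y"
  shows "superjet S u x p H"
  unfolding superjet_def
proof (intro conjI allI impI)
  show "linear H" using assms(1) by (simp add: superjet_def)
  fix e :: real assume "e > 0"
  then obtain s where s: "s > 0"
    "\<forall>y\<in>S \<inter> ball x s. w y \<le> w x + p \<bullet> (y - x) + H (y - x) \<bullet> (y - x) / 2 + e * (norm (y - x))\<^sup>2"
    using assms(1) unfolding superjet_def by meson
  have "u y \<le> u x + p \<bullet> (y - x) + H (y - x) \<bullet> (y - x) / 2 + e * (norm (y - x))\<^sup>2"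
    if "y \<in> S \<inter> ball x (min r s)" for y
    using that s(2)[rule_format, of y] assms(2) assms(4)[of y] by force
  then show "\<exists>r>0. \<forall>y\<in>S \<inter> ball x r. u y \<le> u x + p \<bullet> (y - x) + H (y - x) \<bullet> (y - x) / 2 + e * (norm (y - x))\<^sup>2"
    using assms(3) s(1) by (intro exI[of _ "min r s"]) auto
qed

lemma linear_growth_le_zero:
  fixes a b s :: real
  assumes "s > 0" and "\<And>t. 0 < t \<Longrightarrow> t < s \<Longrightarrow> t * a \<le> t\<^sup>2 * b"
  shows "a \<le> 0"
proof (rule tendsto_lowerbound[where F = "at_right 0" and f = "\<lambda>t. t * b"])
  show "((\<lambda>t. t * b) \<longlongrightarrow> 0) (at_right 0)" by (auto intro!: tendsto_eq_intros)
  show "\<forall>\<^sub>F t in at_right 0. a \<le> t * b"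
    unfolding eventually_at_right_field using assms
    by (intro exI[of _ s]) (simp add: power2_eq_square mult.assoc)
qed simp

text \<open>Both expansions are compared at \<open>x + t v\<close>: order t gives the first claim
  and, once the gradients agree, order t squared gives the second. Only directions entering
  \<open>S\<close> are available, so at a boundary point the gradients need not coincide.\<close>

lemma superjet_taylor2_direction:
  assumes T: "taylor2 \<phi> x p H" and J: "superjet S \<phi> x q K"
    and s: "s > 0" "\<And>t. 0 < t \<Longrightarrow> t < s \<Longrightarrow> x + t *\<^sub>R v \<in> S"
  shows "p \<bullet> v \<le> q \<bullet> v"
    and "q = p \<Longrightarrow> H v \<bullet> v \<le> K v \<bullet> v"
proof -
  have lin: "linear H" "linear K" using T J by (auto simp: taylor2_def superjet_def)
  have key: "\<exists>d>0. \<forall>t. 0 < t \<longrightarrow> t < d \<longrightarrow>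
      t * (p \<bullet> v - q \<bullet> v) \<le> t\<^sup>2 * ((K v \<bullet> v - H v \<bullet> v) / 2 + 2 * e * (norm v)\<^sup>2)"
    if e: "e > 0" for e
  proof -
    obtain r1 where r1: "r1 > 0" "\<forall>y\<in>ball x r1.
       \<bar>\<phi> y - \<phi> x - p \<bullet> (y - x) - H (y - x) \<bullet> (y - x) / 2\<bar> \<le> e * (norm (y - x))\<^sup>2"
      using T e unfolding taylor2_def by meson
    obtain r2 where r2: "r2 > 0"
      "\<forall>y\<in>S \<inter> ball x r2. \<phi> y \<le> \<phi> x + q \<bullet> (y - x) + K (y - x) \<bullet> (y - x) / 2 + e * (norm (y - x))\<^sup>2"
      using J e unfolding superjet_def by meson
    \<comment> \<open>The added 1 keeps the quotient meaningful for \<open>v = 0\<close>.\<close>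
    define d where "d = min s (min r1 r2 / (norm v + 1))"
    have "d > 0" using s r1 r2 by (auto simp: d_def add_nonneg_pos)
    moreover have "t * (p \<bullet> v - q \<bullet> v) \<le> t\<^sup>2 * ((K v \<bullet> v - H v \<bullet> v) / 2 + 2 * e * (norm v)\<^sup>2)"
      if t: "0 < t" "t < d" for t
    proof -
      have "t < min r1 r2 / (norm v + 1)" using t by (simp add: d_def)
      then have "t * (norm v + 1) < min r1 r2"
        by (simp add: add_nonneg_pos pos_less_divide_eq)
      then have "norm (t *\<^sub>R v) < min r1 r2" using t by (simp add: algebra_simps)
      then have "x + t *\<^sub>R v \<in> ball x r1" "x + t *\<^sub>R v \<in> S \<inter> ball x r2"
        using s(2)[of t] t by (auto simp: dist_norm d_def)
      then show ?thesis
        using r1(2)[rule_format, of "x + t *\<^sub>R v"] r2(2)[rule_format, of "x + t *\<^sub>R v"] t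
        by (simp add: abs_le_iff linear_cmul[OF lin(1)] linear_cmul[OF lin(2)] power_mult_distrib
            power2_eq_square field_simps)
    qed
    ultimately show ?thesis by blast
  qed
  show "p \<bullet> v \<le> q \<bullet> v"
  proof -
    obtain d where d: "d > 0" "\<forall>t. 0 < t \<longrightarrow> t < d \<longrightarrow>
      t * (p \<bullet> v - q \<bullet> v) \<le> t\<^sup>2 * ((K v \<bullet> v - H v \<bullet> v) / 2 + 2 * 1 * (norm v)\<^sup>2)" using key[of 1] by auto
    show ?thesis using linear_growth_le_zero[OF d(1), of "p \<bullet> v - q \<bullet> v"] d(2) by auto
  qed
  assume "q = p"
  have "0 \<le> (K v \<bullet> v - H v \<bullet> v) / 2 + 2 * e * (norm v)\<^sup>2" if "e > 0" for e
  proof -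
    obtain d where d: "d > 0" "\<forall>t. 0 < t \<longrightarrow> t < d \<longrightarrow>
      t * (p \<bullet> v - q \<bullet> v) \<le> t\<^sup>2 * ((K v \<bullet> v - H v \<bullet> v) / 2 + 2 * e * (norm v)\<^sup>2)" using key[OF \<open>e > 0\<close>] by auto
    then have "0 \<le> (d/2)\<^sup>2 * ((K v \<bullet> v - H v \<bullet> v) / 2 + 2 * e * (norm v)\<^sup>2)"
      using \<open>q = p\<close> d(2)[rule_format, of "d/2"] by simp
    then show ?thesis using d(1) by (simp add: zero_le_mult_iff)
  qed
  then have "0 \<le> (K v \<bullet> v - H v \<bullet> v) / 2"
  proof (intro tendsto_lowerbound[where F = "at_right (0::real)" and
        f = "\<lambda>e. (K v \<bullet> v - H v \<bullet> v) / 2 + 2 * e * (norm v)\<^sup>2"])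
    show "((\<lambda>e. (K v \<bullet> v - H v \<bullet> v) / 2 + 2 * e * (norm v)\<^sup>2) \<longlongrightarrow> (K v \<bullet> v - H v \<bullet> v) / 2) (at_right 0)"
      by (auto intro!: tendsto_eq_intros)
  qed (auto simp: eventually_at_right_field intro!: exI[of _ 1])
  then show "H v \<bullet> v \<le> K v \<bullet> v" by simp
qed

lemma superjet_taylor2_interior:
  assumes T: "taylor2 \<phi> x p H" and J: "superjet S \<phi> x q K" and "x \<in> interior S"
  shows "q = p" and "H v \<bullet> v \<le> K v \<bullet> v"
proof -
  obtain r where r: "r > 0" "ball x r \<subseteq> S" using assms(3) mem_interior by blast
  have S: "\<exists>s>0. \<forall>t. 0 < t \<longrightarrow> t < s \<longrightarrow> x + t *\<^sub>R v \<in> S" for v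
  proof -
    have "x + t *\<^sub>R v \<in> S" if "0 < t" "t < r / (norm v + 1)" for t
    proof -
      have "t * (norm v + 1) < r" using that by (simp add: add_nonneg_pos pos_less_divide_eq)
      then have "x + t *\<^sub>R v \<in> ball x r" using that by (simp add: dist_norm algebra_simps)
      then show ?thesis using r by auto
    qed
    then show ?thesis using r(1) by (intro exI[of _ "r / (norm v + 1)"]) (auto simp: add_nonneg_pos)
  qed
  have le: "p \<bullet> v \<le> q \<bullet> v" for v
    using S[of v] superjet_taylor2_direction(1)[OF T J, of _ v] by blast
  \<comment> \<open>In the interior every direction is allowed, in particular the difference of the
    two gradients.\<close>
  have "(p - q) \<bullet> (p - q) \<le> 0" using le[of "p - q"] by (simp add: inner_diff_left)
  then show qp: "q = p" by (metis eq_iff_diff_eq_0 inner_ge_zero inner_eq_zero_iff order_antisym)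
  show "H v \<bullet> v \<le> K v \<bullet> v"
    using S[of v] superjet_taylor2_direction(2)[OF T J, of _ v] qp by blast
qed

section \<open>The infinity Laplacian of a jet\<close>

lemma quadratic_form_bound:
  assumes "linear (H :: 'a::euclidean_space \<Rightarrow> 'a)"
  obtains B where "\<And>v. \<bar>H v \<bullet> v\<bar> \<le> B * (norm v)\<^sup>2"
proof -
  obtain B where B: "\<And>v. norm (H v) \<le> B * norm v" using linear_bounded[OF assms] by blast
  have "\<bar>H v \<bullet> v\<bar> \<le> B * (norm v)\<^sup>2" for v
  proof -
    have "\<bar>H v \<bullet> v\<bar> \<le> norm (H v) * norm v" by (rule Cauchy_Schwarz_ineq2)
    also have "\<dots> \<le> B * norm v * norm v" using B by (intro mult_right_mono) auto
    finally show ?thesis by (simp add: power2_eq_square mult.assoc)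
  qed
  then show ?thesis using that by blast
qed

lemma bdd_above_quadratic_form:
  assumes "linear (H :: 'a::euclidean_space \<Rightarrow> 'a)"
  shows "bdd_above {H v \<bullet> v | v. norm v = 1}"
proof -
  obtain B where "\<And>v. \<bar>H v \<bullet> v\<bar> \<le> B * (norm v)\<^sup>2" using quadratic_form_bound[OF assms] by blast
  then have "H v \<bullet> v \<le> B" if "norm v = 1" for v using that by (metis abs_le_D1 mult.right_neutral power_one)
  then show ?thesis by (auto intro!: bdd_aboveI)
qed

lemma nonempty_quadratic_form: "{H v \<bullet> v | v. norm (v::'a::euclidean_space) = 1} \<noteq> {}"
proof -
  obtain v :: 'a where "norm v = 1" using vector_choose_size zero_le_one by blast
  then show ?thesis by blast
qed

lemma rayleigh_normalized:
  assumes "linear H" and "(p::'a::euclidean_space) \<noteq> 0"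
  shows "(H p \<bullet> p) / (norm p)\<^sup>2 = H (p /\<^sub>R norm p) \<bullet> (p /\<^sub>R norm p)"
  using assms(2) by (simp add: linear_cmul[OF assms(1)] power2_eq_square divide_inverse)

lemma rayleigh_le_inf_lap_plus_0:
  assumes "linear H" and "norm v = 1" shows "H v \<bullet> v \<le> inf_lap_plus 0 H"
  using assms bdd_above_quadratic_form[OF assms(1)] by (auto simp: inf_lap_plus_def intro!: cSup_upper)

text \<open>For a nonzero gradient the value is the quadratic form at one unit vector, so it lies
  below the supremum over all of them: the jump at gradient 0 goes upward.\<close>

lemma inf_lap_plus_le_0:
  assumes "linear H" shows "inf_lap_plus p H \<le> inf_lap_plus 0 H"
proof (cases "p = 0")
  case False
  then have "inf_lap_plus p H = H (p /\<^sub>R norm p) \<bullet> (p /\<^sub>R norm p)"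
    using rayleigh_normalized[OF assms False] by (simp add: inf_lap_plus_def)
  then show ?thesis using rayleigh_le_inf_lap_plus_0[OF assms, of "p /\<^sub>R norm p"] False by simp
qed simp

text \<open>Degenerate ellipticity with slack: \<open>inf_lap_plus\<close> evaluates the form on
  unit vectors only, where \<open>c * (norm v)\<^sup>2\<close> is the constant
  \<open>c\<close>.\<close>

lemma inf_lap_plus_mono:
  assumes lin: "linear K" and le: "\<And>v. H v \<bullet> v \<le> K v \<bullet> v + c * (norm v)\<^sup>2"
  shows "inf_lap_plus p H \<le> inf_lap_plus p K + c"
proof (cases "p = 0")
  case True
  have "H v \<bullet> v \<le> inf_lap_plus 0 K + c" if "norm v = 1" for v
    using le[of v] rayleigh_le_inf_lap_plus_0[OF lin that] that by simp
  then have "Sup {H v \<bullet> v | v. norm v = 1} \<le> inf_lap_plus 0 K + c"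
    by (intro cSup_least nonempty_quadratic_form) auto
  then show ?thesis by (simp add: inf_lap_plus_def True)
next
  case False
  then show ?thesis using le[of p] by (simp add: inf_lap_plus_def field_simps)
qed

text \<open>The left side is the lower infinity Laplacian written out. The two coincide at a nonzero
  gradient; at 0 any single unit vector separates minimum from maximum.\<close>

lemma inf_lap_minus_le_plus:
  assumes "linear H" shows "- inf_lap_plus (- p) (\<lambda>v. - H v) \<le> inf_lap_plus p H"
proof (cases "p = 0")
  case True
  obtain v :: 'a where v: "norm v = 1" using vector_choose_size zero_le_one by blast
  have "linear (\<lambda>v. - H v)" using assms by (rule linear_compose_neg)
  from rayleigh_le_inf_lap_plus_0[OF this v] rayleigh_le_inf_lap_plus_0[OF assms v]
  show ?thesis using True by simp
qed (simp add: inf_lap_plus_def linear_neg[OF assms])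

text \<open>Away from 0 the Rayleigh quotient is continuous; at 0 the value dominates all
  neighbouring ones. This carries a strict inequality from one point to its neighbourhood.\<close>

lemma inf_lap_plus_usc:
  fixes H :: "'a::euclidean_space \<Rightarrow> 'a"
  assumes lin: "linear H" and "e > 0"
  shows "\<forall>\<^sub>F q in nhds p. inf_lap_plus q H < inf_lap_plus p H + e"
proof (cases "p = 0")
  case True
  have "inf_lap_plus q H < inf_lap_plus p H + e" for q
    using inf_lap_plus_le_0[OF lin, of q] True \<open>e > 0\<close> by simp
  then show ?thesis by simp
next
  case False
  have "(H \<longlongrightarrow> H p) (nhds p)"
    by (metis lin linear_continuous_at linear_conv_bounded_linear isCont_def tendsto_at_iff_tendsto_nhds)
  then have "((\<lambda>q. (H q \<bullet> q) / (norm q)\<^sup>2) \<longlongrightarrow> (H p \<bullet> p) / (norm p)\<^sup>2) (nhds p)"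
    using False by (intro tendsto_intros filterlim_ident) auto
  then have "\<forall>\<^sub>F q in nhds p. (H q \<bullet> q) / (norm q)\<^sup>2 < (H p \<bullet> p) / (norm p)\<^sup>2 + e"
    using \<open>e > 0\<close> by (intro order_tendstoD) auto
  moreover have "\<forall>\<^sub>F q in nhds p. q \<noteq> 0" using False by (simp add: t1_space_nhds)
  ultimately show ?thesis by eventually_elim (simp add: inf_lap_plus_def False)
qed

section \<open>Viscosity subsolutions in terms of jets\<close>

text \<open>The self-adjoint part of \<open>H\<close> shifted by \<open>c\<close> times the
  identity. A self-adjoint map is the Hessian of its own quadratic form; the shift absorbs the error
  term of a jet.\<close>

definition symm :: "('a::euclidean_space \<Rightarrow> 'a) \<Rightarrow> real \<Rightarrow> 'a \<Rightarrow> 'a" where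
  "symm H c v = (1/2) *\<^sub>R (H v + adjoint H v) + c *\<^sub>R v"

lemma
  assumes "linear H"
  shows linear_symm: "linear (symm H c)"
    and symm_sym: "symm H c v \<bullet> w = v \<bullet> symm H c w"
    and symm_form: "symm H c v \<bullet> v = H v \<bullet> v + c * (norm v)\<^sup>2"
proof -
  have adj: "adjoint H v \<bullet> w = v \<bullet> H w" "H v \<bullet> w = v \<bullet> adjoint H w" for v w
    using adjoint_clauses[OF assms] adjoint_adjoint[OF assms] by (auto simp: inner_commute)
  have "linear (\<lambda>v. (1/2) *\<^sub>R (H v + adjoint H v) + c *\<^sub>R v)"
    by (intro linear_compose_add linear_compose_scale_right assms adjoint_linear linear_ident)
  then show "linear (symm H c)" by (simp add: symm_def[abs_def])
  show "symm H c v \<bullet> w = v \<bullet> symm H c w"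
    by (simp add: symm_def inner_add_left inner_add_right adj)
  show "symm H c v \<bullet> v = H v \<bullet> v + c * (norm v)\<^sup>2"
    by (simp add: symm_def inner_add_left power2_norm_eq_inner adj(1) inner_commute[of v "H v"])
qed

lemma C2_with_quadratic:
  assumes "linear H" and sym: "\<And>v w. H v \<bullet> w = v \<bullet> H w"
  shows "C2_with (\<lambda>y. c + p \<bullet> (y - x0) + H (y - x0) \<bullet> (y - x0) / 2) (\<lambda>y. p + H (y - x0)) (\<lambda>_. H)"
proof -
  have swap: "H v \<bullet> w = H w \<bullet> v" for v w using sym by (simp add: inner_commute)
  have bl: "bounded_linear H" using assms(1) by (simp add: linear_conv_bounded_linear)
  have H: "((\<lambda>y. H (y - x0)) has_derivative H) (at x)" for x
    by (rule bounded_linear.has_derivative[OF bl]) (auto intro!: derivative_eq_intros)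
  have "((\<lambda>y. c + p \<bullet> (y - x0) + H (y - x0) \<bullet> (y - x0) / 2) has_derivative
      (\<lambda>h. (p + H (x - x0)) \<bullet> h)) (at x)" for x
    apply (rule has_derivative_eq_rhs)
     apply (rule derivative_intros H)+
     apply simp
    apply (rule ext)
    subgoal for h using swap[of h "x - x0"] by (simp add: inner_add_left)
    done
  then show ?thesis unfolding C2_with_def
    using H by (auto intro!: derivative_eq_intros)
qed

text \<open>A C2 function touching from above yields a superjet by Taylor expansion. Conversely, a
  superjet is realised by a quadratic test function whose Hessian is enlarged enough to absorb the
  error; this costs an arbitrarily small amount in the equation.\<close>

lemma visc_sub_iff_superjet:
  "visc_sub \<Omega> \<Gamma> \<nu> \<beta> f u \<longleftrightarrow> usc_on (closure \<Omega>) u \<and>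
     (\<forall>x0\<in>\<Omega> \<union> \<Gamma>. \<forall>p H. superjet (closure \<Omega>) u x0 p H \<longrightarrow>
        (- inf_lap_plus p H - \<beta> * norm p \<le> f x0 \<or> (x0 \<in> \<Gamma> \<and> p \<bullet> \<nu> x0 \<le> 0)))"
    (is "_ \<longleftrightarrow> _ \<and> ?J")
proof -
  have "?J" if sub: "visc_sub \<Omega> \<Gamma> \<nu> \<beta> f u"
  proof (intro ballI allI impI)
    fix x0 p H assume x0: "x0 \<in> \<Omega> \<union> \<Gamma>" and J: "superjet (closure \<Omega>) u x0 p H"
    then have lin: "linear H" by (simp add: superjet_def)
    show "- inf_lap_plus p H - \<beta> * norm p \<le> f x0 \<or> (x0 \<in> \<Gamma> \<and> p \<bullet> \<nu> x0 \<le> 0)"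
    proof (rule disjCI)
      assume no: "\<not> (x0 \<in> \<Gamma> \<and> p \<bullet> \<nu> x0 \<le> 0)"
      have "- inf_lap_plus p H - \<beta> * norm p \<le> f x0 + 2 * e" if e: "e > 0" for e
      proof -
        \<comment> \<open>The form enters the quadratic with factor 1/2, so a shift by
          \<open>2 * e\<close> pays for the jet error
          \<open>e * (norm (y - x0))\<^sup>2\<close>.\<close>
        let ?K = "symm H (2 * e)"
        have K: "linear ?K" "\<And>v w. ?K v \<bullet> w = v \<bullet> ?K w" using linear_symm symm_sym lin by auto
        let ?\<phi> = "\<lambda>y. u x0 + p \<bullet> (y - x0) + ?K (y - x0) \<bullet> (y - x0) / 2"
        have C2: "C2_with ?\<phi> (\<lambda>y. p + ?K (y - x0)) (\<lambda>_. ?K)" by (rule C2_with_quadratic[OF K])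
        obtain r where r: "r > 0" "\<forall>y\<in>closure \<Omega> \<inter> ball x0 r.
            u y \<le> u x0 + p \<bullet> (y - x0) + H (y - x0) \<bullet> (y - x0) / 2 + e * (norm (y - x0))\<^sup>2"
          using J e unfolding superjet_def by meson
        then have "loc_max_rel (closure \<Omega>) (\<lambda>y. u y - ?\<phi> y) x0"
          unfolding loc_max_rel_def symm_form[OF lin]
          by (intro exI[of _ r]) (fastforce simp: field_simps linear_0[OF lin])
        from sub[unfolded visc_sub_def, THEN conjunct2, rule_format, OF C2 x0 this]
        have "- inf_lap_plus p ?K - \<beta> * norm p \<le> f x0"
          using no by (simp add: linear_0[OF K(1)])
        moreover have "inf_lap_plus p ?K \<le> inf_lap_plus p H + 2 * e"
          by (rule inf_lap_plus_mono[OF lin]) (simp add: symm_form[OF lin])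
        ultimately show ?thesis by linarith
      qed
      then have "- inf_lap_plus p H - \<beta> * norm p \<le> f x0 + e" if "e > 0" for e
        using that by (metis field_sum_of_halves half_gt_zero mult_2)
      then show "- inf_lap_plus p H - \<beta> * norm p \<le> f x0" by (rule field_le_epsilon)
    qed
  qed
  moreover have "visc_sub \<Omega> \<Gamma> \<nu> \<beta> f u" if "usc_on (closure \<Omega>) u" and J: ?J
    unfolding visc_sub_def
  proof (intro conjI allI impI that)
    fix phi Dphi Hphi x0
    assume C2: "C2_with phi Dphi Hphi" and x0: "x0 \<in> \<Omega> \<union> \<Gamma>"
      and m: "loc_max_rel (closure \<Omega>) (\<lambda>x. u x - phi x) x0"
    have "taylor2 phi x0 (Dphi x0) (Hphi x0)"
      using C2 by (intro taylor2I[where r = 1]) (auto simp: C2_with_def)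
    from J[rule_format, OF x0 superjet_of_loc_max[OF m this]]
    show "- inf_lap_plus (Dphi x0) (Hphi x0) - \<beta> * norm (Dphi x0) \<le> f x0 \<or>
        x0 \<in> \<Gamma> \<and> Dphi x0 \<bullet> \<nu> x0 \<le> 0" .
  qed
  ultimately show ?thesis unfolding visc_sub_def by blast
qed

lemmas visc_subD = visc_sub_iff_superjet[THEN iffD1, THEN conjunct2, rule_format]

text \<open>Reflection exchanges maxima with minima and the two infinity Laplacians, but leaves the
  norm of the gradient alone; hence \<beta> must change sign along with \<open>f\<close>.\<close>

lemma visc_super_iff_visc_sub:
  "visc_super \<Omega> \<Gamma> \<nu> \<beta> f v \<longleftrightarrow> visc_sub \<Omega> \<Gamma> \<nu> (- \<beta>) (\<lambda>x. - f x) (\<lambda>x. - v x)"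
proof -
  have C2: "C2_with (\<lambda>x. - phi x) (\<lambda>x. - Dphi x) (\<lambda>x h. - Hphi x h)" if "C2_with phi Dphi Hphi"
    for phi :: "'a \<Rightarrow> real" and Dphi Hphi
    using that unfolding C2_with_def
    by (auto intro!: has_derivative_minus[of phi, THEN has_derivative_eq_rhs]
        has_derivative_minus[of Dphi] continuous_intros)
  have usc: "usc_on S (\<lambda>x. - v x) \<longleftrightarrow> lsc_on S v" for S
    unfolding usc_on_def lsc_on_def by (simp add: algebra_simps)
  have mm: "loc_max_rel S (\<lambda>x. - v x - phi x) x0 \<longleftrightarrow> loc_min_rel S (\<lambda>x. v x - (- phi x)) x0" for S phi x0
    unfolding loc_max_rel_def loc_min_rel_def by (simp add: algebra_simps)
  show ?thesis
  proof
    assume L: "visc_super \<Omega> \<Gamma> \<nu> \<beta> f v"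
    show "visc_sub \<Omega> \<Gamma> \<nu> (- \<beta>) (\<lambda>x. - f x) (\<lambda>x. - v x)"
      unfolding visc_sub_def usc
    proof (intro conjI allI impI)
      show "lsc_on (closure \<Omega>) v" using L by (simp add: visc_super_def)
      fix phi Dphi Hphi x0
      assume a: "C2_with phi Dphi Hphi" "x0 \<in> \<Omega> \<union> \<Gamma>" "loc_max_rel (closure \<Omega>) (\<lambda>x. - v x - phi x) x0"
      from L[unfolded visc_super_def, THEN conjunct2, rule_format, OF C2[OF a(1)] a(2) a(3)[unfolded mm]]
      show "- inf_lap_plus (Dphi x0) (Hphi x0) - (- \<beta>) * norm (Dphi x0) \<le> - f x0 \<or>
         x0 \<in> \<Gamma> \<and> Dphi x0 \<bullet> \<nu> x0 \<le> 0"
        by (auto simp: inf_lap_minus_def)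
    qed
  next
    assume L: "visc_sub \<Omega> \<Gamma> \<nu> (- \<beta>) (\<lambda>x. - f x) (\<lambda>x. - v x)"
    show "visc_super \<Omega> \<Gamma> \<nu> \<beta> f v"
      unfolding visc_super_def
    proof (intro conjI allI impI)
      show "lsc_on (closure \<Omega>) v" using L by (simp add: visc_sub_def usc)
      fix phi Dphi Hphi x0
      assume a: "C2_with phi Dphi Hphi" "x0 \<in> \<Omega> \<union> \<Gamma>" "loc_min_rel (closure \<Omega>) (\<lambda>x. v x - phi x) x0"
      have "loc_max_rel (closure \<Omega>) (\<lambda>x. - v x - (- phi x)) x0" unfolding mm using a(3) by simp
      from L[unfolded visc_sub_def, THEN conjunct2, rule_format, OF C2[OF a(1)] a(2) this]
      show "f x0 \<le> - inf_lap_minus (Dphi x0) (Hphi x0) - \<beta> * norm (Dphi x0) \<or>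
         x0 \<in> \<Gamma> \<and> 0 \<le> Dphi x0 \<bullet> \<nu> x0"
        by (auto simp: inf_lap_minus_def)
    qed
  qed
qed

section \<open>Radial cones\<close>

text \<open>The differential inequality makes G(|x - y|) a strict supersolution, away from y, for
  right-hand sides below c.\<close>

definition strict_cone :: "real \<Rightarrow> real \<Rightarrow> real \<Rightarrow> (real \<Rightarrow> real) \<Rightarrow> bool" where
  "strict_cone b c R G \<longleftrightarrow> G 0 = 0 \<and> (\<exists>G' G''.
     (\<forall>r. (G has_real_derivative G' r) (at r)) \<and> (\<forall>r. (G' has_real_derivative G'' r) (at r)) \<and>
     (\<forall>r\<in>{0..R}. 0 < G' r \<and> G'' r + b * G' r \<le> - c))"

lemma strict_cone_continuous: "strict_cone b c R G \<Longrightarrow> continuous_on S G"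
  unfolding strict_cone_def by (meson DERIV_continuous_on has_field_derivative_at_within)

lemma strict_cone_isCont: "strict_cone b c R G \<Longrightarrow> isCont G r"
  unfolding strict_cone_def by (meson DERIV_isCont)

lemma strict_cone_nonneg:
  assumes "strict_cone b c R G" and "0 \<le> r" and "r \<le> R" shows "0 \<le> G r"
proof -
  obtain G' where "\<And>r. (G has_real_derivative G' r) (at r)" "\<And>r. r \<in> {0..R} \<Longrightarrow> 0 < G' r"
    using assms(1) unfolding strict_cone_def by metis
  then have "\<exists>y. (G has_real_derivative y) (at x) \<and> 0 \<le> y" if "0 \<le> x" "x \<le> r" for x
    using that assms(3) by (intro exI[of _ "G' x"]) (simp add: less_imp_le)
  then have "G 0 \<le> G r" by (rule DERIV_nonneg_imp_nondecreasing[OF assms(2)])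
  then show ?thesis using assms(1) by (simp add: strict_cone_def)
qed

text \<open>The witness solves G'' + a G' = -|c| explicitly, with a = b + 1 so that a is positive
  even for b = 0. As G' is positive, replacing a by the smaller b only lowers the left side.\<close>

lemma strict_cone_exists:
  fixes b c d R C :: real
  assumes "0 \<le> b" and "d > 0"
  obtains G where "strict_cone b c R G" and "\<And>r. d \<le> r \<Longrightarrow> r \<le> R \<Longrightarrow> C \<le> G r"
proof -
  define a where "a = b + 1"
  \<comment> \<open>A slope of at least \<open>m\<close> makes the cone exceed |C| at distance
    \<open>d\<close>.\<close>
  define m where "m = 1 + \<bar>C\<bar> / d"
  \<comment> \<open>This \<open>K\<close> gives \<open>G' R = m\<close>; \<open>G'\<close> is
    decreasing, so its slope on the whole interval is at least \<open>m\<close>.\<close>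
  define K where "K = exp (a * R) * (\<bar>c\<bar> / a + m)"
  define G where "G r = K / a * (1 - exp (- (a * r))) - \<bar>c\<bar> / a * r" for r
  define G' where "G' r = K * exp (- (a * r)) - \<bar>c\<bar> / a" for r
  define G'' where "G'' r = - (a * K) * exp (- (a * r))" for r
  have a: "a > 0" "a \<ge> b" using assms by (auto simp: a_def)
  have m: "m \<ge> 1" using assms by (simp add: m_def)
  have K: "K > 0" using a m by (auto simp: K_def intro!: mult_pos_pos add_nonneg_pos)
  have d1: "(G has_real_derivative G' r) (at r)" for r
    unfolding G_def G'_def using a by (auto intro!: derivative_eq_intros)
  have d2: "(G' has_real_derivative G'' r) (at r)" for r
    unfolding G'_def G''_def by (auto intro!: derivative_eq_intros)
  have slope: "m \<le> G' r" if "r \<le> R" for r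
  proof -
    have "K * exp (- (a * R)) \<le> K * exp (- (a * r))" using that a K by simp
    moreover have "K * exp (- (a * R)) = \<bar>c\<bar> / a + m" by (simp add: K_def exp_minus field_simps)
    ultimately show ?thesis by (simp add: G'_def)
  qed
  have ode: "G'' r + b * G' r \<le> - c" if "r \<le> R" for r
  proof -
    have "G'' r + a * G' r = - \<bar>c\<bar>" using a by (simp add: G'_def G''_def field_simps)
    moreover have "b * G' r \<le> a * G' r" using slope[OF that] m a by (intro mult_right_mono) auto
    ultimately show ?thesis by linarith
  qed
  have "strict_cone b c R G"
    unfolding strict_cone_def
  proof (intro conjI exI)
    show "G 0 = 0" by (simp add: G_def)
    show "\<forall>r\<in>{0..R}. 0 < G' r \<and> G'' r + b * G' r \<le> - c"
      using ode slope m by (smt (verit) atLeastAtMost_iff)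
  qed (use d1 d2 in blast)+
  moreover have "C \<le> G r" if r: "d \<le> r" "r \<le> R" for r
  proof -
    have "r > 0" using r assms by linarith
    obtain z where z: "0 < z" "z < r" "G r - G 0 = (r - 0) * G' z"
      using MVT2[OF \<open>r > 0\<close>, of G G'] d1 by blast
    have "d * m = d + \<bar>C\<bar>" using assms by (simp add: m_def field_simps)
    then have "C \<le> d * m" using assms by linarith
    also have "\<dots> \<le> r * G' z" using r z slope[of z] m assms by (intro mult_mono) auto
    finally show ?thesis using z by (simp add: G_def)
  qed
  ultimately show ?thesis using that by blast
qed

text \<open>The gradient is radial and the radial direction is an eigenvector of the Hessian with
  eigenvalue G''; the tangential curvature G'/r never enters. So the infinity Laplacian is
  one-dimensional here.\<close>

lemma radial_jet:
  fixes x y :: "'a::euclidean_space"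
  assumes G: "strict_cone \<bar>\<beta>\<bar> c R G" and xy: "x \<noteq> y" and R: "dist x y \<le> R"
  obtains k H where "taylor2 (\<lambda>z. G (dist z y)) x (k *\<^sub>R (x - y)) H" and "k > 0"
    and "inf_lap_plus (k *\<^sub>R (x - y)) H + \<beta> * norm (k *\<^sub>R (x - y)) \<le> - c"
    and "inf_lap_plus (- (k *\<^sub>R (x - y))) (\<lambda>v. - H v) + \<beta> * norm (k *\<^sub>R (x - y)) \<ge> c"
proof -
  obtain G' G'' where d1: "\<And>r. (G has_real_derivative G' r) (at r)"
    and d2: "\<And>r. (G' has_real_derivative G'' r) (at r)"
    and ode: "\<And>r. r \<in> {0..R} \<Longrightarrow> 0 < G' r \<and> G'' r + \<bar>\<beta>\<bar> * G' r \<le> - c"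
    using G unfolding strict_cone_def by metis
  define r where "r = norm (x - y)"
  have r: "r > 0" "r \<in> {0..R}" using xy R by (auto simp: r_def dist_norm)
  define D where "D z = (G' (norm (z - y)) / norm (z - y)) *\<^sub>R (z - y)" for z
  define k where "k = G' r / r"
  \<comment> \<open>The derivative of \<open>D\<close> at \<open>x\<close> by the quotient and
    product rules: a radial rank-one term plus the tangential curvature \<open>k\<close>.\<close>
  define H where "H h = ((G'' r * (h \<bullet> sgn (x - y)) * r - G' r * (h \<bullet> sgn (x - y))) / (r * r)) *\<^sub>R (x - y)
      + k *\<^sub>R h" for h
  have nrm: "((\<lambda>z. norm (z - y)) has_derivative (\<lambda>h. h \<bullet> sgn (z - y))) (at z)" if "z \<noteq> y" for z
  proof -
    have "((\<lambda>z. z - y) has_derivative (\<lambda>h. h)) (at z)" by (auto intro!: derivative_eq_intros)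
    from has_derivative_compose[OF this has_derivative_norm] that show ?thesis by simp
  qed
  have comp: "((\<lambda>z. g (norm (z - y))) has_derivative (\<lambda>h. g' (norm (z - y)) * (h \<bullet> sgn (z - y)))) (at z)"
    if "\<And>r. (g has_real_derivative g' r) (at r)" "z \<noteq> y" for z g g'
    using has_derivative_compose[OF nrm[OF that(2)] that(1)[THEN has_field_derivative_imp_has_derivative]]
    by simp
  have D1: "((\<lambda>z. G (norm (z - y))) has_derivative (\<lambda>h. D z \<bullet> h)) (at z)" if "z \<noteq> y" for z
    using comp[OF d1 that]
    by (rule has_derivative_eq_rhs) (simp add: D_def sgn_div_norm inner_commute fun_eq_iff divide_inverse)
  have "((\<lambda>z. G' (norm (z - y)) / norm (z - y)) has_derivative
      (\<lambda>h. (G'' r * (h \<bullet> sgn (x - y)) * r - G' r * (h \<bullet> sgn (x - y))) / (r * r))) (at x)"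
    using has_derivative_divide'[OF comp[OF d2 xy] nrm[OF xy]] r unfolding r_def by simp
  from has_derivative_scaleR[OF this, of "\<lambda>z. z - y" "\<lambda>h. h"]
  have D2: "(D has_derivative H) (at x)"
    unfolding D_def[abs_def]
    by (rule has_derivative_eq_rhs) (auto intro!: derivative_eq_intros simp: H_def k_def r_def algebra_simps)
  have T: "taylor2 (\<lambda>z. G (dist z y)) x (k *\<^sub>R (x - y)) H"
  proof -
    have "taylor2 (\<lambda>z. G (norm (z - y))) x (D x) H"
      using r(1) D2 by (intro taylor2I[where r = r] D1) (auto simp: r_def dist_norm)
    then show ?thesis by (simp add: D_def k_def r_def dist_norm)
  qed
  have lin: "linear H" using T by (simp add: taylor2_def)
  have k: "k > 0" using ode[OF r(2)] r by (simp add: k_def)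
  have sg: "(x - y) \<bullet> sgn (x - y) = r" "(x - y) \<bullet> (x - y) = r\<^sup>2"
    using r by (simp_all add: sgn_div_norm r_def dot_square_norm power2_eq_square)
  have np: "norm (k *\<^sub>R (x - y)) = G' r" using ode[OF r(2)] r by (simp add: r_def[symmetric] k_def)
  \<comment> \<open>On the radial vector the curvature terms cancel and only \<open>G'' r\<close>
    survives.\<close>
  have "(G'' r * r * r - G' r * r) / (r * r) + k = G'' r"
    using r(1) by (simp add: k_def field_simps)
  then have "H (x - y) = G'' r *\<^sub>R (x - y)"
    by (simp only: H_def sg scaleR_add_left[symmetric])
  then have "H (x - y) \<bullet> (x - y) = G'' r * r\<^sup>2" by (simp only: inner_scaleR_left sg)
  then have "H (k *\<^sub>R (x - y)) \<bullet> (k *\<^sub>R (x - y)) = G'' r * (norm (k *\<^sub>R (x - y)))\<^sup>2"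
    using k by (simp add: linear_cmul[OF lin] power_mult_distrib r_def[symmetric] power2_eq_square)
  moreover have "k *\<^sub>R (x - y) \<noteq> 0" using k xy by simp
  ultimately have il: "inf_lap_plus (k *\<^sub>R (x - y)) H = G'' r"
    "inf_lap_plus (- (k *\<^sub>R (x - y))) (\<lambda>v. - H v) = - G'' r"
    by (simp_all add: inf_lap_plus_def linear_neg[OF lin])
  have "\<bar>\<beta> * G' r\<bar> = \<bar>\<beta>\<bar> * G' r" using ode[OF r(2)] by (simp add: abs_mult)
  with ode[OF r(2)] have "G'' r + \<beta> * G' r \<le> - c" "- G'' r + \<beta> * G' r \<ge> c" by linarith+
  then show ?thesis using that[OF T k] il np by simp
qed

section \<open>Semicontinuity\<close>

lemma continuous_on_linear_shift:
  fixes H :: "'a::euclidean_space \<Rightarrow> 'a"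
  assumes "linear H" shows "continuous_on S (\<lambda>x. H (x - x0))"
proof -
  have "continuous_on S (\<lambda>x. x - x0)" by (intro continuous_intros)
  then show ?thesis using assms by (rule linear_continuous_on_compose)
qed

text \<open>Without a maximum, the neighbourhoods on which \<open>u\<close> stays below some value
  \<open>u y\<close> cover the compact set. Finitely many \<open>y\<close> suffice, but the best of
  them is covered by none.\<close>

lemma usc_on_attains_max:
  fixes u :: "'a::metric_space \<Rightarrow> real"
  assumes "compact S" and "S \<noteq> {}" and "usc_on S u"
  shows "\<exists>x\<in>S. \<forall>y\<in>S. u y \<le> u x"
proof (rule ccontr)
  assume "\<not> ?thesis"
  then have ex: "\<exists>y\<in>S. u x < u y" if "x \<in> S" for x using that by (auto simp: not_le)
  obtain d where d: "\<And>x e. x \<in> S \<Longrightarrow> e > 0 \<Longrightarrow> d x e > 0 \<and> (\<forall>y\<in>S. dist y x < d x e \<longrightarrow> u y < u x + e)"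
    using assms(3) unfolding usc_on_def by metis
  \<comment> \<open>At every point of \<open>S\<close> inside \<open>U y\<close> the value of
    \<open>u\<close> is less than \<open>u y\<close>.\<close>
  define U where "U y = (\<Union>x\<in>{x\<in>S. u x < u y}. ball x (d x (u y - u x)))" for y
  have opU: "open (U y)" for y by (auto simp: U_def)
  have cover: "S \<subseteq> (\<Union>y\<in>S. U y)"
  proof
    fix x assume x: "x \<in> S"
    then obtain y where y: "y \<in> S" "u x < u y" using ex by blast
    then have "x \<in> ball x (d x (u y - u x))" using d[OF x] by simp
    then show "x \<in> (\<Union>y\<in>S. U y)" using x y unfolding U_def by blast
  qed
  obtain C where C: "C \<subseteq> S" "finite C" "S \<subseteq> (\<Union>y\<in>C. U y)"
    by (rule compactE_image[OF assms(1) opU cover])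
  then have "C \<noteq> {}" using assms(2) by auto
  then have "Max (u ` C) \<in> u ` C" using C(2) by (intro Max_in) auto
  then obtain m where m: "m \<in> C" "Max (u ` C) = u m" by blast
  then have mx: "u y \<le> u m" if "y \<in> C" for y using C(2) that by (metis Max_ge finite_imageI imageI)
  obtain y x where yx: "y \<in> C" "x \<in> S" "u x < u y" "m \<in> ball x (d x (u y - u x))"
    using m C unfolding U_def by blast
  then have "u m < u x + (u y - u x)"
    using d[OF yx(2), of "u y - u x"] m C by (auto simp: dist_commute)
  then show False using mx[OF yx(1)] by simp
qed

lemma usc_on_minus_continuous:
  fixes u h :: "'a::metric_space \<Rightarrow> real"
  assumes "usc_on S u" and "continuous_on S h"
  shows "usc_on S (\<lambda>x. u x - h x)"
  unfolding usc_on_def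
proof (intro ballI allI impI)
  fix x and e :: real assume x: "x \<in> S" and e: "e > 0"
  obtain d1 where d1: "d1 > 0" "\<forall>y\<in>S. dist y x < d1 \<longrightarrow> u y < u x + e / 2"
    using assms(1) x e unfolding usc_on_def by (meson half_gt_zero)
  obtain d2 where d2: "d2 > 0" "\<forall>y\<in>S. dist y x < d2 \<longrightarrow> dist (h y) (h x) < e / 2"
    using assms(2) x e unfolding continuous_on_iff by (meson half_gt_zero)
  have "u y - h y < u x - h x + e" if "y \<in> S" "dist y x < min d1 d2" for y
  proof -
    have "u y < u x + e / 2" "\<bar>h y - h x\<bar> < e / 2"
      using d1(2) d2(2) that by (auto simp: dist_real_def)
    then show ?thesis by linarith
  qed
  then show "\<exists>d>0. \<forall>y\<in>S. dist y x < d \<longrightarrow> u y - h y < u x - h x + e"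
    using d1 d2 by (intro exI[of _ "min d1 d2"]) auto
qed

lemma continuous_on_imp_usc_on:
  fixes u :: "'a::metric_space \<Rightarrow> real"
  assumes "continuous_on S u" shows "usc_on S u"
  unfolding usc_on_def
proof (intro ballI allI impI)
  fix x and e :: real assume "x \<in> S" "e > 0"
  then obtain d where d: "d > 0" "\<forall>y\<in>S. dist y x < d \<longrightarrow> dist (u y) (u x) < e"
    using assms unfolding continuous_on_iff by meson
  then have "\<forall>y\<in>S. dist y x < d \<longrightarrow> u y < u x + e" by (auto simp: dist_real_def abs_less_iff)
  with d(1) show "\<exists>d>0. \<forall>y\<in>S. dist y x < d \<longrightarrow> u y < u x + e" by blast
qed

lemma usc_on_max:
  fixes u w :: "'a::metric_space \<Rightarrow> real"
  assumes "usc_on S u" and "usc_on S w" shows "usc_on S (\<lambda>x. max (u x) (w x))"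
  unfolding usc_on_def
proof (intro ballI allI impI)
  fix x and e :: real assume x: "x \<in> S" "e > 0"
  obtain d1 where d1: "d1 > 0" "\<forall>y\<in>S. dist y x < d1 \<longrightarrow> u y < u x + e"
    using assms(1) x unfolding usc_on_def by blast
  obtain d2 where d2: "d2 > 0" "\<forall>y\<in>S. dist y x < d2 \<longrightarrow> w y < w x + e"
    using assms(2) x unfolding usc_on_def by blast
  have "max (u y) (w y) < max (u x) (w x) + e" if "y \<in> S" "dist y x < min d1 d2" for y
  proof -
    have "u y < u x + e" "w y < w x + e" using d1(2) d2(2) that by auto
    then show ?thesis by linarith
  qed
  then show "\<exists>d>0. \<forall>y\<in>S. dist y x < d \<longrightarrow> max (u y) (w y) < max (u x) (w x) + e"
    using d1(1) d2(1) by (intro exI[of _ "min d1 d2"]) auto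
qed

lemma usc_on_subset:
  assumes "usc_on S u" and "T \<subseteq> S" shows "usc_on T u"
  unfolding usc_on_def
proof (intro ballI allI impI)
  fix x and e :: real assume "x \<in> T" "e > 0"
  then have "\<exists>d>0. \<forall>y\<in>S. dist y x < d \<longrightarrow> u y < u x + e"
    using assms unfolding usc_on_def by (simp add: subset_iff)
  then show "\<exists>d>0. \<forall>y\<in>T. dist y x < d \<longrightarrow> u y < u x + e" using assms(2) by (meson subsetD)
qed

section \<open>The outward normal\<close>

text \<open>The defining function vanishes at \<open>p\<close>, so the sign of its derivative along
  a ray decides on which side the ray starts.\<close>

lemma defining_function_direction:
  fixes p :: "'a::euclidean_space"
  assumes "open \<Omega>" and p: "p \<in> frontier \<Omega>" and U: "open U" "p \<in> U" and C1: "C1_grad_on U \<rho> D"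
    and eq: "\<Omega> \<inter> U = {x\<in>U. \<rho> x < 0}"
  shows "D p \<bullet> v < 0 \<Longrightarrow> \<exists>s>0. \<forall>t. 0 < t \<longrightarrow> t < s \<longrightarrow> p + t *\<^sub>R v \<in> \<Omega>"
    and "D p \<bullet> v > 0 \<Longrightarrow> \<exists>s>0. \<forall>t. 0 < t \<longrightarrow> t < s \<longrightarrow> p + t *\<^sub>R v \<notin> \<Omega>"
proof -
  have der: "(\<rho> has_derivative (\<lambda>h. D p \<bullet> h)) (at p)" using C1 U by (simp add: C1_grad_on_def)
  have "p \<notin> \<Omega>" using p assms(1) by (simp add: frontier_def interior_open)
  then have "\<rho> p \<ge> 0" using eq U by fastforce
  moreover have "\<rho> p \<le> 0"
  proof (rule ccontr)
    \<comment> \<open>A positive value would persist near \<open>p\<close> and cut \<open>p\<close>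
      off from the closure of \<Omega>.\<close>
    assume "\<not> \<rho> p \<le> 0"
    then have "\<forall>\<^sub>F x in nhds p. \<rho> x > 0 \<and> x \<in> U"
      using has_derivative_continuous[OF der] U
      by (intro eventually_conj eventually_nhds_in_open order_tendstoD(1)[of \<rho> "\<rho> p"])
        (auto simp: isCont_def continuous_at tendsto_at_iff_tendsto_nhds)
    then obtain V where V: "open V" "p \<in> V" "\<forall>x\<in>V. \<rho> x > 0 \<and> x \<in> U" unfolding eventually_nhds by blast
    have "\<not> \<rho> x < 0 \<and> x \<in> U" if "x \<in> V" for x using V(3) that by fastforce
    then have "V \<inter> \<Omega> = {}" using eq V(3) by blast
    moreover have "p \<in> closure \<Omega>" using p by (simp add: frontier_def)
    ultimately show False using V open_Int_closure_eq_empty[of V \<Omega>] by blast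
  qed
  ultimately have rp: "\<rho> p = 0" by simp
  have rd: "((\<lambda>t. \<rho> (p + t *\<^sub>R v)) has_real_derivative D p \<bullet> v) (at 0)"
  proof -
    have "((\<lambda>t. p + t *\<^sub>R v) has_derivative (\<lambda>s. s *\<^sub>R v)) (at 0)" by (auto intro!: derivative_eq_intros)
    from has_derivative_compose[OF this, of \<rho> "\<lambda>h. D p \<bullet> h"] der
    show ?thesis by (simp add: has_field_derivative_def mult.commute[of _ "D p \<bullet> v"])
  qed
  have "((\<lambda>t. p + t *\<^sub>R v) \<longlongrightarrow> p + 0 *\<^sub>R v) (at_right 0)" by (intro tendsto_intros)
  then have "\<forall>\<^sub>F t in at_right 0. p + t *\<^sub>R v \<in> U" using U by (intro topological_tendstoD) auto
  then obtain s0 where s0: "s0 > 0" "\<And>t. 0 < t \<Longrightarrow> t < s0 \<Longrightarrow> p + t *\<^sub>R v \<in> U"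
    unfolding eventually_at_right_field by blast
  show "\<exists>s>0. \<forall>t. 0 < t \<longrightarrow> t < s \<longrightarrow> p + t *\<^sub>R v \<in> \<Omega>" if neg: "D p \<bullet> v < 0"
  proof -
    obtain s1 where s1: "s1 > 0" "\<forall>h>0. h < s1 \<longrightarrow> \<rho> (p + h *\<^sub>R v) < 0"
      using DERIV_neg_dec_right[OF rd neg] rp by auto
    have "p + t *\<^sub>R v \<in> \<Omega>" if "0 < t" "t < min s0 s1" for t
    proof -
      have "p + t *\<^sub>R v \<in> {x\<in>U. \<rho> x < 0}" using s0(2) s1(2) that by auto
      then show ?thesis using eq by blast
    qed
    then show ?thesis using s0(1) s1(1) by (intro exI[of _ "min s0 s1"]) auto
  qed
  show "\<exists>s>0. \<forall>t. 0 < t \<longrightarrow> t < s \<longrightarrow> p + t *\<^sub>R v \<notin> \<Omega>" if pos: "D p \<bullet> v > 0"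
  proof -
    obtain s1 where s1: "s1 > 0" "\<forall>h>0. h < s1 \<longrightarrow> \<rho> (p + h *\<^sub>R v) > 0"
      using DERIV_pos_inc_right[OF rd pos] rp by auto
    have "p + t *\<^sub>R v \<notin> \<Omega>" if "0 < t" "t < min s0 s1" for t
    proof
      assume "p + t *\<^sub>R v \<in> \<Omega>"
      moreover have "p + t *\<^sub>R v \<in> U" "\<rho> (p + t *\<^sub>R v) > 0" using s0(2) s1(2) that by auto
      ultimately have "p + t *\<^sub>R v \<in> {x\<in>U. \<rho> x < 0}" using eq by blast
      then show False using \<open>\<rho> (p + t *\<^sub>R v) > 0\<close> by simp
    qed
    then show ?thesis using s0(1) s1(1) by (intro exI[of _ "min s0 s1"]) auto
  qed
qed

text \<open>An open half-space determines its unit normal. Testing with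
  \<open>n - (c + e) m\<close>, which lies just inside the half-space of \<open>m\<close>, forces
  the cosine \<open>c\<close> up to 1.\<close>

lemma unit_vector_eqI:
  fixes m n :: "'a::euclidean_space"
  assumes "norm m = 1" "norm n = 1" and H: "\<And>v. m \<bullet> v < 0 \<Longrightarrow> n \<bullet> v \<le> 0"
  shows "m = n"
proof -
  have sq: "m \<bullet> m = 1" "n \<bullet> n = 1" using assms by (simp_all add: dot_square_norm)
  define c where "c = m \<bullet> n"
  have c1: "c \<le> 1" using Cauchy_Schwarz_ineq2[of m n] assms by (simp add: c_def)
  have c0: "0 \<le> c" using H[of "- m"] sq by (simp add: c_def inner_commute)
  have "1 \<le> c + e" if e: "e > 0" for e
  proof -
    have "m \<bullet> (n - (c + e) *\<^sub>R m) < 0" using e sq by (simp add: inner_diff_right c_def)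
    from H[OF this] have "1 \<le> (c + e) * c" by (simp add: inner_diff_right c_def inner_commute sq)
    also have "\<dots> \<le> (c + e) * 1" using c0 c1 e by (intro mult_left_mono) auto
    finally show ?thesis by simp
  qed
  then have "1 \<le> c" by (rule field_le_epsilon)
  then have "(m - n) \<bullet> (m - n) \<le> 0"
    by (simp add: inner_diff_left inner_diff_right sq c_def inner_commute)
  then show ?thesis by (metis eq_iff_diff_eq_0 inner_ge_zero inner_eq_zero_iff order_antisym)
qed

context
  fixes \<Omega> :: "'a::euclidean_space set" and \<nu> :: "'a \<Rightarrow> 'a"
  assumes op: "open \<Omega>" and nor: "C1_domain_normal \<Omega> \<nu>"
begin

lemma normal_directions:
  assumes p: "p \<in> frontier \<Omega>"
  shows "norm (\<nu> p) = 1"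
    and "\<nu> p \<bullet> v < 0 \<Longrightarrow> \<exists>s>0. \<forall>t. 0 < t \<longrightarrow> t < s \<longrightarrow> p + t *\<^sub>R v \<in> \<Omega>"
    and "\<nu> p \<bullet> v > 0 \<Longrightarrow> \<exists>s>0. \<forall>t. 0 < t \<longrightarrow> t < s \<longrightarrow> p + t *\<^sub>R v \<notin> \<Omega>"
proof -
  obtain U \<rho> D where U: "open U" "p \<in> U" "C1_grad_on U \<rho> D" "\<forall>x\<in>U. D x \<noteq> 0"
    "\<Omega> \<inter> U = {x\<in>U. \<rho> x < 0}" and n: "\<nu> p = D p /\<^sub>R norm (D p)"
    using nor p unfolding C1_domain_normal_def by meson
  have "norm (D p) > 0" using U by auto
  then show "norm (\<nu> p) = 1" by (simp add: n)
  show "\<exists>s>0. \<forall>t. 0 < t \<longrightarrow> t < s \<longrightarrow> p + t *\<^sub>R v \<in> \<Omega>" if "\<nu> p \<bullet> v < 0"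
    using defining_function_direction(1)[OF op p U(1-3,5)] that \<open>norm (D p) > 0\<close>
    by (auto simp: n mult_less_0_iff)
  show "\<exists>s>0. \<forall>t. 0 < t \<longrightarrow> t < s \<longrightarrow> p + t *\<^sub>R v \<notin> \<Omega>" if "\<nu> p \<bullet> v > 0"
    using defining_function_direction(2)[OF op p U(1-3,5)] that \<open>norm (D p) > 0\<close>
    by (auto simp: n zero_less_mult_iff)
qed

text \<open>At each boundary point \<nu> may come from a different defining function. Near
  \<open>p\<close> all of them give the same normal as the one chosen at \<open>p\<close>, because
  the normal is determined by the directions that enter \<Omega>; continuity then comes from that
  single gradient field.\<close>

lemma continuous_on_normal: "continuous_on (frontier \<Omega>) \<nu>"
  unfolding continuous_on_def
proof
  fix p assume p: "p \<in> frontier \<Omega>"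
  obtain U \<rho> D where U: "open U" "p \<in> U" "C1_grad_on U \<rho> D" "\<forall>x\<in>U. D x \<noteq> 0"
    "\<Omega> \<inter> U = {x\<in>U. \<rho> x < 0}" and n: "\<nu> p = D p /\<^sub>R norm (D p)"
    using nor p unfolding C1_domain_normal_def by meson
  have eq: "D q /\<^sub>R norm (D q) = \<nu> q" if q: "q \<in> frontier \<Omega>" "q \<in> U" for q
  proof (rule sym, rule unit_vector_eqI)
    show "norm (\<nu> q) = 1" by (rule normal_directions(1)[OF q(1)])
    have "norm (D q) > 0" using U q by auto
    then show "norm (D q /\<^sub>R norm (D q)) = 1" by simp
    fix v assume "\<nu> q \<bullet> v < 0"
    then obtain s1 where s1: "s1 > 0" "\<forall>t. 0 < t \<longrightarrow> t < s1 \<longrightarrow> q + t *\<^sub>R v \<in> \<Omega>"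
      using normal_directions(2)[OF q(1)] by blast
    show "(D q /\<^sub>R norm (D q)) \<bullet> v \<le> 0"
    proof (rule ccontr)
      assume "\<not> ?thesis"
      then have "D q \<bullet> v > 0" using \<open>norm (D q) > 0\<close> by (auto simp: not_le zero_less_mult_iff)
      then obtain s2 where s2: "s2 > 0" "\<forall>t. 0 < t \<longrightarrow> t < s2 \<longrightarrow> q + t *\<^sub>R v \<notin> \<Omega>"
        using defining_function_direction(2)[OF op q(1) U(1) q(2) U(3,5)] by blast
      define t where "t = min s1 s2 / 2"
      have "0 < t" "t < s1" "t < s2" using s1(1) s2(1) by (auto simp: t_def min_def)
      then show False using s1(2) s2(2) by blast
    qed
  qed
  have "continuous_on U (\<lambda>q. D q /\<^sub>R norm (D q))"
    using U by (intro continuous_intros) (auto simp: C1_grad_on_def)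
  then have "isCont (\<lambda>q. D q /\<^sub>R norm (D q)) p"
    using U(1,2) by (simp add: continuous_on_eq_continuous_at)
  then have "((\<lambda>q. D q /\<^sub>R norm (D q)) \<longlongrightarrow> \<nu> p) (at p)" unfolding isCont_def n .
  then have "((\<lambda>q. D q /\<^sub>R norm (D q)) \<longlongrightarrow> \<nu> p) (at p within frontier \<Omega>)"
    by (rule tendsto_within_subset) simp
  moreover have "\<forall>\<^sub>F q in at p within frontier \<Omega>. D q /\<^sub>R norm (D q) = \<nu> q"
    unfolding eventually_at_topological using U eq by blast
  ultimately show "(\<nu> \<longlongrightarrow> \<nu> p) (at p within frontier \<Omega>)"
    using Lim_transform_eventually by blast
qed

text \<open>If some \<open>z\<close> in \<Omega> lay beyond the tangent plane at \<open>x\<close>,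
  the segment to \<open>z\<close> would leave \<Omega> at once, against convexity. Strictness comes
  from openness at \<open>y\<close>.\<close>

lemma convex_imp_oblique:
  assumes "convex \<Omega>" and x: "x \<in> frontier \<Omega>" and y: "y \<in> \<Omega>"
  shows "(x - y) \<bullet> \<nu> x > 0"
proof -
  have le: "\<nu> x \<bullet> (z - x) \<le> 0" if z: "z \<in> \<Omega>" for z
  proof (rule ccontr)
    assume "\<not> ?thesis"
    then obtain s where s: "s > 0" "\<forall>t. 0 < t \<longrightarrow> t < s \<longrightarrow> x + t *\<^sub>R (z - x) \<notin> \<Omega>"
      using normal_directions(3)[OF x, of "z - x"] by (auto simp: not_le)
    define t where "t = min (s/2) 1"
    have t: "0 < t" "t < s" "t \<le> 1" using s(1) by (auto simp: t_def)
    have "x - t *\<^sub>R (x - z) \<in> interior \<Omega>"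
      using x z op t by (intro mem_interior_closure_convex_shrink[OF assms(1)]) (auto simp: interior_open frontier_def)
    then show False using s(2) t op by (simp add: interior_open scaleR_diff_right algebra_simps)
  qed
  obtain s where s: "s > 0" "cball y s \<subseteq> \<Omega>" using op y open_contains_cball by blast
  have n: "norm (\<nu> x) = 1" by (rule normal_directions(1)[OF x])
  \<comment> \<open>Pushing \<open>y\<close> outward by \<open>s\<close> keeps it in \<Omega>, so
    the weak inequality there leaves a margin \<open>s\<close> at \<open>y\<close>.\<close>
  then have "y + s *\<^sub>R \<nu> x \<in> \<Omega>" using s by (auto simp: dist_norm subset_iff)
  from le[OF this] have "\<nu> x \<bullet> (y - x) + s \<le> 0"
    using n by (simp add: inner_diff_right inner_add_right dot_square_norm)
  then show ?thesis using s(1) by (simp add: inner_diff_left inner_diff_right inner_commute)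
qed

end

section \<open>Comparison with cones and barriers\<close>

text \<open>\<open>oblique\<close> stands in for convexity. It is vacuous when the Neumann part is
  empty, so both cases of the geometric hypothesis are covered.\<close>

locale mixed_domain =
  fixes \<Omega> A :: "'a::euclidean_space set" and \<nu> :: "'a \<Rightarrow> 'a"
  assumes bounded_domain: "bounded \<Omega>" and open_domain: "open \<Omega>"
    and normal: "C1_domain_normal \<Omega> \<nu>" and open_A: "open A"
    and dirichlet_nonempty: "frontier \<Omega> - A \<noteq> {}"
    and oblique: "\<And>x y. x \<in> frontier \<Omega> \<inter> A \<Longrightarrow> y \<in> \<Omega> \<Longrightarrow> (x - y) \<bullet> \<nu> x > 0"
begin

abbreviation \<Gamma>N :: "'a set" where "\<Gamma>N \<equiv> frontier \<Omega> \<inter> A"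
abbreviation \<Gamma>D :: "'a set" where "\<Gamma>D \<equiv> frontier \<Omega> - A"
abbreviation R :: real where "R \<equiv> diameter (closure \<Omega>)"

lemma compact_closure_domain: "compact (closure \<Omega>)"
  using bounded_domain by (simp add: compact_closure)

lemma dist_le_R: "x \<in> closure \<Omega> \<Longrightarrow> y \<in> closure \<Omega> \<Longrightarrow> dist x y \<le> R"
  by (rule diameter_bounded_bound[OF bounded_closure[OF bounded_domain]])

lemma frontier_eq: "frontier \<Omega> = closure \<Omega> - \<Omega>"
  using open_domain by (simp add: frontier_def interior_open)

lemma closure_domain_eq: "closure \<Omega> = \<Omega> \<union> \<Gamma>N \<union> \<Gamma>D"
  using frontier_eq closure_subset[of \<Omega>] by blast

lemma compact_dirichlet: "compact \<Gamma>D"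
  using bounded_domain open_A by (intro compact_diff compact_frontier_bounded)

lemma dirichlet_far:
  assumes "x \<in> \<Omega> \<union> \<Gamma>N" obtains s where "s > 0" and "ball x s \<inter> \<Gamma>D = {}"
proof -
  have "open (- \<Gamma>D)" by (intro open_Compl compact_imp_closed compact_dirichlet)
  moreover have "x \<in> - \<Gamma>D" using assms frontier_eq by blast
  ultimately obtain s where "s > 0" "ball x s \<subseteq> - \<Gamma>D" using open_contains_ball by blast
  then show ?thesis using that by blast
qed

lemma oblique_closure:
  assumes "x \<in> \<Gamma>N" and "y \<in> closure \<Omega>" shows "(x - y) \<bullet> \<nu> x \<ge> 0"
proof -
  have "\<nu> x \<bullet> z \<le> \<nu> x \<bullet> x" if "z \<in> \<Omega>" for z
    using oblique[OF assms(1) that] by (simp add: inner_diff_left inner_commute[of "\<nu> x"])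
  then have "closure \<Omega> \<subseteq> {y. \<nu> x \<bullet> y \<le> \<nu> x \<bullet> x}"
    by (intro closure_minimal closed_halfspace_le) blast
  then show ?thesis using assms(2) by (auto simp: inner_diff_left inner_commute[of "\<nu> x"])
qed

lemma inward_normal:
  assumes "x \<in> frontier \<Omega>"
  shows "\<exists>s>0. \<forall>t. 0 < t \<longrightarrow> t < s \<longrightarrow> x + t *\<^sub>R (- \<nu> x) \<in> closure \<Omega>"
proof -
  have "\<nu> x \<bullet> (- \<nu> x) < 0"
    using normal_directions(1)[OF open_domain normal assms] by (simp add: dot_square_norm)
  from normal_directions(2)[OF open_domain normal assms this] show ?thesis
    using closure_subset by blast
qed

text \<open>At a boundary point a superjet gradient may differ from the true one, but moving along
  the inward normal shows that its outward normal component can only be smaller. A Neumann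
  inequality of subsolution type therefore survives.\<close>

lemma superjet_normal:
  assumes "x \<in> frontier \<Omega>" and T: "taylor2 \<phi> x p H" and J: "superjet (closure \<Omega>) \<phi> x q K"
  shows "q \<bullet> \<nu> x \<le> p \<bullet> \<nu> x"
proof -
  obtain s where "s > 0" "\<And>t. 0 < t \<Longrightarrow> t < s \<Longrightarrow> x + t *\<^sub>R (- \<nu> x) \<in> closure \<Omega>"
    using inward_normal[OF assms(1)] by blast
  from superjet_taylor2_direction(1)[OF T J this] show ?thesis by simp
qed

text \<open>The inequality persists near x0 even when p = 0, because the relaxed infinity Laplacian is
  upper semicontinuous in the gradient.\<close>

lemma strict_jet_nbhd:
  assumes x0: "x0 \<in> \<Omega> \<union> \<Gamma>N" and lin: "linear H" and f: "continuous_on (\<Omega> \<union> \<Gamma>N) f"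
    and strict: "inf_lap_plus p H + \<beta> * norm p + f x0 < 0"
    and neu: "x0 \<in> \<Gamma>N \<Longrightarrow> p \<bullet> \<nu> x0 > 0"
  shows "\<exists>s>0. \<forall>x\<in>closure \<Omega> \<inter> ball x0 s. x \<in> \<Omega> \<union> \<Gamma>N \<and>
     inf_lap_plus (p + H (x - x0)) H + \<beta> * norm (p + H (x - x0)) + f x < 0 \<and>
     (x \<in> \<Gamma>N \<longrightarrow> (p + H (x - x0)) \<bullet> \<nu> x > 0)"
proof -
  define P where "P x = p + H (x - x0)" for x
  \<comment> \<open>A quarter of the strict gap: the infinity Laplacian, the gradient term and
    \<open>f\<close> may each grow by \<open>e\<close>.\<close>
  define e where "e = - (inf_lap_plus p H + \<beta> * norm p + f x0) / 4"
  have e: "e > 0" using strict by (simp add: e_def)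
  have P0: "P x0 = p" by (simp add: P_def linear_0[OF lin])
  have contP: "continuous_on S P" for S
    unfolding P_def by (intro continuous_on_add continuous_on_const continuous_on_linear_shift lin)
  then have "(P \<longlongrightarrow> p) (nhds x0)"
    by (metis P0 UNIV_I continuous_on_eq_continuous_at isCont_def open_UNIV tendsto_at_iff_tendsto_nhds)
  then have "\<forall>\<^sub>F x in nhds x0. inf_lap_plus (P x) H < inf_lap_plus p H + e"
    by (rule eventually_compose_filterlim[OF inf_lap_plus_usc[OF lin e]])
  moreover have "\<forall>\<^sub>F x in nhds x0. \<beta> * norm (P x) < \<beta> * norm p + e"
    using e \<open>(P \<longlongrightarrow> p) (nhds x0)\<close> by (intro order_tendstoD(2)[of _ "\<beta> * norm p"] tendsto_intros) auto
  ultimately have "\<forall>\<^sub>F x in nhds x0. inf_lap_plus (P x) H + \<beta> * norm (P x) < inf_lap_plus p H + \<beta> * norm p + 2 * e"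
    by eventually_elim simp
  then obtain s1 where s1: "s1 > 0"
    "\<And>x. dist x x0 < s1 \<Longrightarrow> inf_lap_plus (P x) H + \<beta> * norm (P x) < inf_lap_plus p H + \<beta> * norm p + 2 * e"
    unfolding eventually_nhds_metric by blast
  obtain s2 where s2: "s2 > 0" "\<forall>x\<in>\<Omega> \<union> \<Gamma>N. dist x x0 < s2 \<longrightarrow> dist (f x) (f x0) < e"
    using f x0 e unfolding continuous_on_iff by meson
  obtain s3 where s3: "s3 > 0" "ball x0 s3 \<inter> \<Gamma>D = {}" by (rule dirichlet_far[OF x0])
  have "\<exists>s4>0. \<forall>x\<in>frontier \<Omega>. dist x x0 < s4 \<longrightarrow> P x \<bullet> \<nu> x > 0"
  proof (cases "x0 \<in> \<Gamma>N")
    case True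
    have "continuous_on (frontier \<Omega>) (\<lambda>x. P x \<bullet> \<nu> x)"
      by (intro continuous_intros contP continuous_on_normal[OF open_domain normal])
    then obtain d where d: "d > 0" "\<forall>x\<in>frontier \<Omega>. dist x x0 < d \<longrightarrow> dist (P x \<bullet> \<nu> x) (P x0 \<bullet> \<nu> x0) < p \<bullet> \<nu> x0"
      using neu[OF True] True unfolding continuous_on_iff by (meson IntD1)
    have "P x \<bullet> \<nu> x > 0" if "x \<in> frontier \<Omega>" "dist x x0 < d" for x
      using d(2)[rule_format, OF that] by (simp add: dist_real_def P0)
    then show ?thesis using d(1) by blast
  next
    case False
    then have "x0 \<in> \<Omega>" using x0 by blast
    then obtain s where "s > 0" "ball x0 s \<subseteq> \<Omega>" using open_domain open_contains_ball by blast
    then show ?thesis using frontier_eq by (intro exI[of _ s]) (auto simp: dist_commute subset_iff)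
  qed
  then obtain s4 where s4: "s4 > 0" "\<forall>x\<in>frontier \<Omega>. dist x x0 < s4 \<longrightarrow> P x \<bullet> \<nu> x > 0" by blast
  define s where "s = min (min s1 s2) (min s3 s4)"
  have "x \<in> \<Omega> \<union> \<Gamma>N \<and> inf_lap_plus (P x) H + \<beta> * norm (P x) + f x < 0 \<and> (x \<in> \<Gamma>N \<longrightarrow> P x \<bullet> \<nu> x > 0)"
    if x: "x \<in> closure \<Omega> \<inter> ball x0 s" for x
  proof -
    have d: "dist x x0 < s1" "dist x x0 < s2" "x \<in> ball x0 s3" "dist x x0 < s4"
      using x by (auto simp: s_def dist_commute)
    then have x': "x \<in> \<Omega> \<union> \<Gamma>N" using x s3 closure_domain_eq by blast
    have "dist (f x) (f x0) < e" using s2 x' d by blast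
    then have "f x < f x0 + e" by (simp add: dist_real_def abs_less_iff)
    then have "inf_lap_plus (P x) H + \<beta> * norm (P x) + f x < 0"
      using s1(2)[OF d(1)] e by (simp add: e_def field_simps)
    then show ?thesis using x' s4 d by blast
  qed
  moreover have "s > 0" using s1 s2 s3 s4 by (simp add: s_def)
  ultimately show ?thesis unfolding P_def by blast
qed

end

lemma visc_sub_max:
  assumes u: "visc_sub \<Omega> \<Gamma> \<nu> \<beta> f u" and w: "visc_sub \<Omega> \<Gamma> \<nu> \<beta> f w"
  shows "visc_sub \<Omega> \<Gamma> \<nu> \<beta> f (\<lambda>x. max (u x) (w x))"
  unfolding visc_sub_iff_superjet
proof (intro conjI ballI allI impI)
  show "usc_on (closure \<Omega>) (\<lambda>x. max (u x) (w x))"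
    using u w by (intro usc_on_max) (auto simp: visc_sub_def)
  fix x p H assume x: "x \<in> \<Omega> \<union> \<Gamma>" and J: "superjet (closure \<Omega>) (\<lambda>x. max (u x) (w x)) x p H"
  consider "max (u x) (w x) = u x" | "max (u x) (w x) = w x" by linarith
  then show "- inf_lap_plus p H - \<beta> * norm p \<le> f x \<or> x \<in> \<Gamma> \<and> p \<bullet> \<nu> x \<le> 0"
  proof cases
    case 1
    then have "superjet (closure \<Omega>) u x p H" by (intro superjet_antimono[OF J, of u 1]) auto
    then show ?thesis by (rule visc_subD[OF u x])
  next
    case 2
    then have "superjet (closure \<Omega>) w x p H" by (intro superjet_antimono[OF J, of w 1]) auto
    then show ?thesis by (rule visc_subD[OF w x])
  qed
qed

text \<open>The bound \<open>c\<close> is strict so that a cone satisfying its inequality with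
  \<open>c\<close> violates the subsolution condition strictly. It is stable under negating the
  data, so the locale can be used for the reflected problem as well.\<close>

locale mixed_problem = mixed_domain \<Omega> A \<nu>
  for \<Omega> A :: "'a::euclidean_space set" and \<nu> :: "'a \<Rightarrow> 'a" +
  fixes \<beta> c :: real and f g :: "'a \<Rightarrow> real"
  assumes continuous_f: "continuous_on (\<Omega> \<union> \<Gamma>N) f"
    and f_bound: "\<And>x. x \<in> \<Omega> \<union> \<Gamma>N \<Longrightarrow> \<bar>f x\<bar> < c"
    and continuous_g: "continuous_on \<Gamma>D g"
begin

abbreviation "subsol \<equiv> visc_sub \<Omega> \<Gamma>N \<nu> \<beta> f"
abbreviation "steep_cone \<equiv> strict_cone \<bar>\<beta>\<bar> c R"

lemma continuous_on_cone: "steep_cone G \<Longrightarrow> continuous_on S (\<lambda>x. G (dist x y))"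
proof -
  assume "steep_cone G"
  then have "continuous_on UNIV G" by (rule strict_cone_continuous)
  moreover have "continuous_on S (\<lambda>x. dist x y)" by (intro continuous_intros)
  ultimately show ?thesis by (rule continuous_on_compose2) simp
qed

lemma cone_nonneg: "steep_cone G \<Longrightarrow> x \<in> closure \<Omega> \<Longrightarrow> y \<in> closure \<Omega> \<Longrightarrow> 0 \<le> G (dist x y)"
  by (rule strict_cone_nonneg[OF _ zero_le_dist dist_le_R])

text \<open>If the claim fails, \<open>u\<close> minus the cone has a maximum above
  \<open>B\<close>. It cannot lie on the Dirichlet part, and elsewhere the strict cone inequality or
  the strict oblique condition contradicts the subsolution property.\<close>

lemma cone_comparison_interior:
  assumes u: "subsol u" and G: "steep_cone G" and y: "y \<in> \<Omega>" and uy: "u y \<le> B"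
    and bd: "\<And>z. z \<in> \<Gamma>D \<Longrightarrow> u z \<le> B + G (dist z y)" and x: "x \<in> closure \<Omega>"
  shows "u x \<le> B + G (dist x y)"
proof -
  have "usc_on (closure \<Omega>) (\<lambda>z. u z - G (dist z y))"
    using u by (intro usc_on_minus_continuous continuous_on_cone[OF G]) (simp add: visc_sub_def)
  moreover have "closure \<Omega> \<noteq> {}" using x by (metis empty_iff)
  ultimately obtain m where m: "m \<in> closure \<Omega>"
    and "\<forall>z\<in>closure \<Omega>. u z - G (dist z y) \<le> u m - G (dist m y)"
    using usc_on_attains_max[OF compact_closure_domain] by meson
  then have mx: "u z - G (dist z y) \<le> u m - G (dist m y)" if "z \<in> closure \<Omega>" for z using that by simp
  have y': "y \<in> closure \<Omega>" using y closure_subset by blast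
  have "u m - G (dist m y) \<le> B"
  proof (rule ccontr)
    assume no: "\<not> ?thesis"
    have "G 0 = 0" using G by (simp add: strict_cone_def)
    \<comment> \<open>This keeps the maximum away from the vertex, where the cone has no jet to test
      with.\<close>
    then have my: "m \<noteq> y" using no uy by auto
    have m': "m \<in> \<Omega> \<union> \<Gamma>N" using no bd[of m] m closure_domain_eq by force
    obtain k H where T: "taylor2 (\<lambda>z. G (dist z y)) m (k *\<^sub>R (m - y)) H" and k: "k > 0"
      and le: "inf_lap_plus (k *\<^sub>R (m - y)) H + \<beta> * norm (k *\<^sub>R (m - y)) \<le> - c"
      using radial_jet[OF G my dist_le_R[OF m y']] by metis
    have "loc_max_rel (closure \<Omega>) (\<lambda>z. u z - G (dist z y)) m"
      unfolding loc_max_rel_def using mx by (auto intro: exI[of _ 1])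
    from visc_subD[OF u m' superjet_of_loc_max[OF this T]]
    show False
    proof
      assume "- inf_lap_plus (k *\<^sub>R (m - y)) H - \<beta> * norm (k *\<^sub>R (m - y)) \<le> f m"
      then show False using le f_bound[OF m'] by linarith
    next
      assume "m \<in> \<Gamma>N \<and> k *\<^sub>R (m - y) \<bullet> \<nu> m \<le> 0"
      then show False using oblique[of m y] y k by (auto simp: mult_le_0_iff)
    qed
  qed
  then show ?thesis using mx[OF x] by linarith
qed

text \<open>For a vertex on the boundary the oblique condition is not strict, so the vertex is approximated
  from inside.\<close>

lemma cone_comparison:
  assumes u: "subsol u" and G: "steep_cone G" and y: "y \<in> closure \<Omega>" and uy: "u y \<le> B"
    and bd: "\<And>z. z \<in> \<Gamma>D \<Longrightarrow> u z \<le> B + G (dist z y)" and x: "x \<in> closure \<Omega>"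
  shows "u x \<le> B + G (dist x y)"
proof (rule field_le_epsilon)
  fix e0 :: real assume "e0 > 0"
  define e where "e = e0 / 2"
  have e: "e > 0" using \<open>e0 > 0\<close> by (simp add: e_def)
  obtain d1 where d1: "d1 > 0" "\<forall>z\<in>closure \<Omega>. dist z y < d1 \<longrightarrow> u z < u y + e"
    using u y e unfolding visc_sub_def usc_on_def by meson
  \<comment> \<open>Moving the vertex must change the cone by less than \<open>e\<close> at all
    points simultaneously; this and the rise of \<open>u\<close> at the new vertex add up to
    \<open>e0\<close>.\<close>
  have "uniformly_continuous_on {0..R} G"
    by (intro compact_uniformly_continuous strict_cone_continuous[OF G]) simp
  then obtain d2 where d2: "d2 > 0" "\<forall>r\<in>{0..R}. \<forall>s\<in>{0..R}. dist s r < d2 \<longrightarrow> dist (G s) (G r) < e"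
    using e unfolding uniformly_continuous_on_def by meson
  obtain y' where y': "y' \<in> \<Omega>" "dist y' y < min d1 d2"
    using y d1(1) d2(1) unfolding closure_approachable by (meson min_less_iff_conj)
  have y'c: "y' \<in> closure \<Omega>" using y' closure_subset by blast
  have near: "\<bar>G (dist z y') - G (dist z y)\<bar> < e" if "z \<in> closure \<Omega>" for z
  proof -
    have "\<bar>dist z y' - dist z y\<bar> \<le> dist y' y"
      using dist_triangle[of z y' y] dist_triangle[of z y y'] by (simp add: dist_commute abs_le_iff)
    then have "dist (dist z y') (dist z y) < d2" using y' by (simp add: dist_real_def)
    then have "dist (G (dist z y')) (G (dist z y)) < e"
      using d2(2) dist_le_R[OF that y] dist_le_R[OF that y'c] by simp
    then show ?thesis by (simp add: dist_real_def)
  qed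
  have uy': "u y' \<le> B + e" using d1(2) y' y'c uy by force
  have bd': "u z \<le> (B + e) + G (dist z y')" if z: "z \<in> \<Gamma>D" for z
  proof -
    have "z \<in> closure \<Omega>" using z closure_domain_eq by blast
    from near[OF this] bd[OF z] show ?thesis by linarith
  qed
  have "u x \<le> (B + e) + G (dist x y')" by (rule cone_comparison_interior[OF u G y'(1) uy' bd' x])
  then show "u x \<le> B + G (dist x y) + e0" using near[OF x] unfolding e_def by linarith
qed

text \<open>The apex is a Dirichlet point, hence never tested. In the interior the jet of the smooth
  cone decides; at a Neumann point the gradient points toward \<open>y\<close>, so its outward
  normal component is nonpositive.\<close>

lemma subsol_inverted_cone:
  assumes G: "steep_cone G" and y: "y \<in> \<Gamma>D"
  shows "subsol (\<lambda>x. B - G (dist x y))"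
  unfolding visc_sub_iff_superjet
proof (intro conjI ballI allI impI)
  show "usc_on (closure \<Omega>) (\<lambda>x. B - G (dist x y))"
    by (intro continuous_on_imp_usc_on continuous_intros continuous_on_cone[OF G])
  fix x q K assume x: "x \<in> \<Omega> \<union> \<Gamma>N" and J: "superjet (closure \<Omega>) (\<lambda>x. B - G (dist x y)) x q K"
  have cl: "x \<in> closure \<Omega>" "y \<in> closure \<Omega>" using x y closure_domain_eq by blast+
  have xy: "x \<noteq> y" using x y frontier_eq by auto
  obtain k H where T: "taylor2 (\<lambda>z. G (dist z y)) x (k *\<^sub>R (x - y)) H" and k: "k > 0"
    and ge: "inf_lap_plus (- (k *\<^sub>R (x - y))) (\<lambda>v. - H v) + \<beta> * norm (k *\<^sub>R (x - y)) \<ge> c"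
    using radial_jet[OF G xy dist_le_R[OF cl]] by metis
  note T' = taylor2_uminus[OF T, of B]
  have linK: "linear K" using J by (simp add: superjet_def)
  show "- inf_lap_plus q K - \<beta> * norm q \<le> f x \<or> x \<in> \<Gamma>N \<and> q \<bullet> \<nu> x \<le> 0"
  proof (cases "x \<in> \<Gamma>N")
    case True
    then have "q \<bullet> \<nu> x \<le> - (k *\<^sub>R (x - y)) \<bullet> \<nu> x" using superjet_normal[OF _ T' J] by simp
    also have "\<dots> \<le> 0" using oblique_closure[OF True cl(2)] k by simp
    finally show ?thesis using True by simp
  next
    case False
    then have "x \<in> interior (closure \<Omega>)"
      using x open_domain interior_maximal[OF closure_subset open_domain] by blast
    note I = superjet_taylor2_interior[OF T' J this]
    have "inf_lap_plus q (\<lambda>v. - H v) \<le> inf_lap_plus q K + 0"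
      using I(2) by (intro inf_lap_plus_mono[OF linK]) simp
    then have "c \<le> inf_lap_plus q K + \<beta> * norm q" using ge unfolding I(1) by simp
    then have "- inf_lap_plus q K - \<beta> * norm q \<le> f x" using f_bound[OF x] by linarith
    then show ?thesis by blast
  qed
qed

lemma bounded_g: "\<exists>C. \<forall>z\<in>\<Gamma>D. \<bar>g z\<bar> \<le> C"
proof -
  have "bounded (g ` \<Gamma>D)"
    by (intro compact_imp_bounded compact_continuous_image continuous_g compact_dirichlet)
  then show ?thesis by (simp add: bounded_iff)
qed

text \<open>Continuity of \<open>g\<close> handles points near \<open>y\<close>; farther away a cone
  of height \<open>2 * C\<close> exceeds the whole oscillation of \<open>g\<close>.\<close>

lemma cone_modulus:
  assumes y: "y \<in> \<Gamma>D" and e: "e > 0"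
  shows "\<exists>G. steep_cone G \<and> (\<forall>z\<in>\<Gamma>D. \<bar>g z - g y\<bar> \<le> e + G (dist z y))"
proof -
  obtain C where C: "\<And>z. z \<in> \<Gamma>D \<Longrightarrow> \<bar>g z\<bar> \<le> C" using bounded_g by blast
  obtain d where d: "d > 0" "\<forall>z\<in>\<Gamma>D. dist z y < d \<longrightarrow> dist (g z) (g y) < e"
    using continuous_g y e unfolding continuous_on_iff by meson
  obtain G where G: "steep_cone G" "\<And>r. d \<le> r \<Longrightarrow> r \<le> R \<Longrightarrow> 2 * C \<le> G r"
    using strict_cone_exists[of "\<bar>\<beta>\<bar>" d c R "2 * C"] d by auto
  have "\<bar>g z - g y\<bar> \<le> e + G (dist z y)" if z: "z \<in> \<Gamma>D" for z
  proof -
    have cl: "z \<in> closure \<Omega>" "y \<in> closure \<Omega>" using z y closure_domain_eq by blast+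
    show ?thesis
    proof (cases "dist z y < d")
      case True
      then have "\<bar>g z - g y\<bar> < e" using d z by (simp add: dist_real_def)
      then show ?thesis using cone_nonneg[OF G(1) cl] by linarith
    next
      case False
      then have "2 * C \<le> G (dist z y)" using G(2) dist_le_R[OF cl] by simp
      then show ?thesis using C[OF z] C[OF y] e by linarith
    qed
  qed
  then show ?thesis using G(1) by blast
qed

end

section \<open>Perron's method\<close>

context mixed_problem
begin

definition admissible :: "('a \<Rightarrow> real) \<Rightarrow> bool" where
  "admissible u \<longleftrightarrow> subsol u \<and> (\<forall>x\<in>\<Gamma>D. u x \<le> g x)"

text \<open>The supremum is informative only on the closure of \<Omega>; elsewhere admissible
  functions take arbitrary values.\<close>

definition perron :: "'a \<Rightarrow> real" where
  "perron x = Sup {u x | u. admissible u}"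

lemma admissible_max: "admissible u \<Longrightarrow> admissible w \<Longrightarrow> admissible (\<lambda>x. max (u x) (w x))"
  by (simp add: admissible_def visc_sub_max)

section \<open>A priori bounds for the admissible family and its supremum\<close>

lemma admissible_bounded_above:
  "\<exists>C. \<forall>u. admissible u \<longrightarrow> (\<forall>x\<in>closure \<Omega>. u x \<le> C)"
proof -
  obtain B where B: "\<And>z. z \<in> \<Gamma>D \<Longrightarrow> \<bar>g z\<bar> \<le> B" using bounded_g by blast
  obtain y where y: "y \<in> \<Gamma>D" using dirichlet_nonempty by blast
  then have yc: "y \<in> closure \<Omega>" using closure_domain_eq by blast
  obtain G where G: "steep_cone G" using strict_cone_exists[of "\<bar>\<beta>\<bar>" 1 c R 0] by auto
  have "bounded ((\<lambda>x. G (dist x y)) ` closure \<Omega>)"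
    by (intro compact_imp_bounded compact_continuous_image continuous_on_cone[OF G] compact_closure_domain)
  then obtain M where M: "\<And>x. x \<in> closure \<Omega> \<Longrightarrow> \<bar>G (dist x y)\<bar> \<le> M" unfolding bounded_iff by auto
  have "u x \<le> B + M" if u: "admissible u" and x: "x \<in> closure \<Omega>" for u x
  proof -
    have le: "u z \<le> B" if "z \<in> \<Gamma>D" for z
      using u B[OF that] that unfolding admissible_def by (smt (verit))
    have "u x \<le> B + G (dist x y)"
    proof (rule cone_comparison[where u = u, OF _ G yc le[OF y] _ x])
      show "subsol u" using u by (simp add: admissible_def)
      fix z assume z: "z \<in> \<Gamma>D"
      then have "z \<in> closure \<Omega>" using closure_domain_eq by blast
      then show "u z \<le> B + G (dist z y)" using le[OF z] cone_nonneg[OF G _ yc] by force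
    qed
    then show ?thesis using M[OF x] by linarith
  qed
  then show ?thesis by blast
qed

lemma admissible_inverted_cone:
  assumes y: "y \<in> \<Gamma>D" and e: "e > 0"
  obtains G where "steep_cone G" and "admissible (\<lambda>x. g y - e - G (dist x y))"
proof -
  obtain G where G: "steep_cone G" "\<And>z. z \<in> \<Gamma>D \<Longrightarrow> \<bar>g z - g y\<bar> \<le> e + G (dist z y)"
    using cone_modulus[OF y e] by blast
  have "g y - e - G (dist z y) \<le> g z" if "z \<in> \<Gamma>D" for z using G(2)[OF that] by linarith
  then have "admissible (\<lambda>x. g y - e - G (dist x y))"
    unfolding admissible_def using subsol_inverted_cone[OF G(1) y] by blast
  then show ?thesis using that G by blast
qed

text \<open>Besides showing that the family is nonempty, this supplies a floor: taking the maximum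
  with \<open>u\<close> makes any admissible function bounded below by \<open>L\<close>.\<close>

lemma admissible_bounded_below:
  "\<exists>u L. admissible u \<and> (\<forall>x\<in>closure \<Omega>. L \<le> u x)"
proof -
  obtain y where y: "y \<in> \<Gamma>D" using dirichlet_nonempty by blast
  obtain G where G: "steep_cone G" "admissible (\<lambda>x. g y - 1 - G (dist x y))"
    by (rule admissible_inverted_cone[OF y zero_less_one])
  have "bounded ((\<lambda>x. G (dist x y)) ` closure \<Omega>)"
    by (intro compact_imp_bounded compact_continuous_image continuous_on_cone[OF G(1)] compact_closure_domain)
  then obtain M where M: "\<And>x. x \<in> closure \<Omega> \<Longrightarrow> \<bar>G (dist x y)\<bar> \<le> M" unfolding bounded_iff by auto
  have "g y - 1 - M \<le> g y - 1 - G (dist x y)" if "x \<in> closure \<Omega>" for x using M[OF that] by linarith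
  then show ?thesis using G(2) by blast
qed

lemma perron_upper:
  assumes "admissible u" and "x \<in> closure \<Omega>" shows "u x \<le> perron x"
proof -
  obtain C where "\<And>u x. admissible u \<Longrightarrow> x \<in> closure \<Omega> \<Longrightarrow> u x \<le> C" using admissible_bounded_above by blast
  then have "bdd_above {u x | u. admissible u}" using assms(2) by (auto intro!: bdd_aboveI)
  then show ?thesis unfolding perron_def using assms(1) by (auto intro!: cSup_upper)
qed

lemma perron_least:
  assumes "\<And>u. admissible u \<Longrightarrow> u x \<le> C" shows "perron x \<le> C"
proof -
  obtain u L where "admissible u" using admissible_bounded_below by blast
  then show ?thesis unfolding perron_def using assms by (intro cSup_least) auto
qed

text \<open>Comparison with cones gives a Lipschitz bound whose constant depends only on the distance of
  the vertex to the Dirichlet boundary, hence it passes to the supremum.\<close>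

lemma perron_cone_bound:
  assumes d: "d > 0"
  shows "\<exists>G. steep_cone G \<and> (\<forall>x\<in>closure \<Omega>. \<forall>y\<in>closure \<Omega>. (\<forall>z\<in>\<Gamma>D. d \<le> dist z y) \<longrightarrow>
    perron x \<le> perron y + G (dist x y))"
proof -
  obtain C where C: "\<And>u x. admissible u \<Longrightarrow> x \<in> closure \<Omega> \<Longrightarrow> u x \<le> C" using admissible_bounded_above by blast
  obtain u0 L where u0: "admissible u0" "\<And>x. x \<in> closure \<Omega> \<Longrightarrow> L \<le> u0 x" using admissible_bounded_below by blast
  \<comment> \<open>\<open>C - L\<close> bounds the oscillation of every admissible function that
    has been raised above \<open>u0\<close>.\<close>
  obtain G where G: "steep_cone G" "\<And>r. d \<le> r \<Longrightarrow> r \<le> R \<Longrightarrow> C - L \<le> G r"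
    using strict_cone_exists[of "\<bar>\<beta>\<bar>" d c R "C - L"] d by auto
  have "perron x \<le> perron y + G (dist x y)"
    if x: "x \<in> closure \<Omega>" and y: "y \<in> closure \<Omega>" and far: "\<forall>z\<in>\<Gamma>D. d \<le> dist z y" for x y
  proof (rule perron_least)
    fix u assume u: "admissible u"
    \<comment> \<open>An arbitrary \<open>u\<close> may be very negative at \<open>y\<close>, and
      then no fixed cone would dominate it on the Dirichlet boundary; raising it to
      \<open>u0\<close> prevents this.\<close>
    define w where "w = (\<lambda>x. max (u x) (u0 x))"
    have w: "admissible w" unfolding w_def by (rule admissible_max[OF u u0(1)])
    have "w x \<le> w y + G (dist x y)"
    proof (rule cone_comparison[where u = w, OF _ G(1) y order_refl _ x])
      show "subsol w" using w by (simp add: admissible_def)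
      fix z assume z: "z \<in> \<Gamma>D"
      then have zc: "z \<in> closure \<Omega>" using closure_domain_eq by blast
      have "L \<le> w y" using u0(2)[OF y] by (simp add: w_def)
      moreover have "C - L \<le> G (dist z y)" using G(2) far z dist_le_R[OF zc y] by blast
      ultimately show "w z \<le> w y + G (dist z y)" using C[OF w zc] by linarith
    qed
    also have "w y \<le> perron y" by (rule perron_upper[OF w y])
    finally show "u x \<le> perron y + G (dist x y)" by (simp add: w_def)
  qed
  then show ?thesis using G(1) by blast
qed

text \<open>The same cone works on both sides: upright, it dominates every admissible function by
  comparison; inverted, it is itself admissible.\<close>

lemma perron_boundary_modulus:
  assumes y: "y \<in> \<Gamma>D" and e: "e > 0"
  shows "\<exists>G. steep_cone G \<and> (\<forall>x\<in>closure \<Omega>. \<bar>perron x - g y\<bar> \<le> e + G (dist x y))"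
proof -
  obtain G where G: "steep_cone G" "\<And>z. z \<in> \<Gamma>D \<Longrightarrow> \<bar>g z - g y\<bar> \<le> e + G (dist z y)"
    using cone_modulus[OF y e] by blast
  have yc: "y \<in> closure \<Omega>" using y closure_domain_eq by blast
  have "\<bar>perron x - g y\<bar> \<le> e + G (dist x y)" if x: "x \<in> closure \<Omega>" for x
  proof -
    have "perron x \<le> g y + e + G (dist x y)"
    proof (rule perron_least)
      fix u assume u: "admissible u"
      show "u x \<le> g y + e + G (dist x y)"
      proof (rule cone_comparison[where u = u, OF _ G(1) yc _ _ x])
        show "subsol u" using u by (simp add: admissible_def)
        show "u y \<le> g y + e" using u y e by (force simp: admissible_def)
        fix z assume "z \<in> \<Gamma>D"
        then show "u z \<le> g y + e + G (dist z y)" using u G(2)[of z] by (force simp: admissible_def)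
      qed
    qed
    moreover have "g y - e - G (dist x y) \<le> perron x"
    proof (rule perron_upper[OF _ x])
      have "g y - e - G (dist z y) \<le> g z" if "z \<in> \<Gamma>D" for z using G(2)[OF that] by linarith
      then show "admissible (\<lambda>x. g y - e - G (dist x y))"
        unfolding admissible_def using subsol_inverted_cone[OF G(1) y] by blast
    qed
    ultimately show ?thesis by linarith
  qed
  then show ?thesis using G(1) by blast
qed

lemma perron_boundary: "y \<in> \<Gamma>D \<Longrightarrow> perron y = g y"
proof -
  assume y: "y \<in> \<Gamma>D"
  have "\<bar>perron y - g y\<bar> \<le> 0 + e" if e: "e > 0" for e
  proof -
    obtain G where G: "steep_cone G" "\<And>x. x \<in> closure \<Omega> \<Longrightarrow> \<bar>perron x - g y\<bar> \<le> e + G (dist x y)"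
      using perron_boundary_modulus[OF y e] by blast
    have "y \<in> closure \<Omega>" using y closure_domain_eq by blast
    from G(2)[OF this] G(1) show ?thesis by (simp add: strict_cone_def)
  qed
  then show ?thesis using field_le_epsilon[of "\<bar>perron y - g y\<bar>" 0] by simp
qed

lemma continuous_on_perron: "continuous_on (closure \<Omega>) perron"
  unfolding continuous_on_iff
proof (intro ballI allI impI)
  fix y and e :: real assume y: "y \<in> closure \<Omega>" and e: "e > 0"
  have "\<exists>G s. steep_cone G \<and> s > 0 \<and>
    (\<forall>x\<in>closure \<Omega>. dist x y < s \<longrightarrow> \<bar>perron x - perron y\<bar> \<le> e / 2 + G (dist x y))"
  proof (cases "y \<in> \<Gamma>D")
    case True
    obtain G where "steep_cone G" "\<And>x. x \<in> closure \<Omega> \<Longrightarrow> \<bar>perron x - g y\<bar> \<le> e / 2 + G (dist x y)"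
      using perron_boundary_modulus[OF True, of "e / 2"] e by (metis half_gt_zero)
    then show ?thesis using perron_boundary[OF True] by (auto intro!: exI[of _ G] exI[of _ 1])
  next
    case False
    then have "y \<in> \<Omega> \<union> \<Gamma>N" using y closure_domain_eq by blast
    then obtain s where s: "s > 0" "ball y s \<inter> \<Gamma>D = {}" by (rule dirichlet_far)
    \<comment> \<open>With \<open>s / 2\<close>, both \<open>y\<close> and every \<open>x\<close>
      within \<open>s / 2\<close> of it stay far enough from the Dirichlet boundary, so the bound
      applies with the two points exchanged.\<close>
    obtain G where G: "steep_cone G" "\<And>x y. x \<in> closure \<Omega> \<Longrightarrow> y \<in> closure \<Omega> \<Longrightarrow> (\<forall>z\<in>\<Gamma>D. s / 2 \<le> dist z y) \<Longrightarrow>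
        perron x \<le> perron y + G (dist x y)"
      using perron_cone_bound[of "s / 2"] s(1) by (metis half_gt_zero)
    have "\<bar>perron x - perron y\<bar> \<le> e / 2 + G (dist x y)" if x: "x \<in> closure \<Omega>" "dist x y < s / 2" for x
    proof -
      have far: "s \<le> dist z y" if "z \<in> \<Gamma>D" for z
      proof -
        have "z \<notin> ball y s" using s(2) that by blast
        then show ?thesis by (simp add: dist_commute)
      qed
      have "s / 2 \<le> dist z y \<and> s / 2 \<le> dist z x" if "z \<in> \<Gamma>D" for z
        using far[OF that] dist_triangle[of z y x] x(2) s(1) by auto
      then have "perron x \<le> perron y + G (dist x y)" "perron y \<le> perron x + G (dist y x)"
        using G(2) x y by blast+
      then show ?thesis using e by (simp add: dist_commute abs_le_iff)
    qed
    then show ?thesis using s G(1) by (intro exI[of _ G] exI[of _ "s / 2"]) auto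
  qed
  then obtain G s where G: "steep_cone G" and s: "s > 0"
    and le: "\<And>x. x \<in> closure \<Omega> \<Longrightarrow> dist x y < s \<Longrightarrow> \<bar>perron x - perron y\<bar> \<le> e / 2 + G (dist x y)" by blast
  have "isCont G 0" using G by (rule strict_cone_isCont)
  moreover have "G 0 = 0" using G by (simp add: strict_cone_def)
  ultimately obtain s' where s': "s' > 0" "\<And>r. dist r 0 < s' \<Longrightarrow> dist (G r) 0 < e / 2"
    using e unfolding continuous_at_eps_delta by (metis half_gt_zero)
  have "dist (perron x) (perron y) < e" if "x \<in> closure \<Omega>" "dist x y < min s s'" for x
    using le[of x] s'(2)[of "dist x y"] that by (auto simp: dist_real_def abs_less_iff)
  then show "\<exists>d>0. \<forall>x\<in>closure \<Omega>. dist x y < d \<longrightarrow> dist (perron x) (perron y) < e"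
    using s s' by (intro exI[of _ "min s s'"]) auto
qed

section \<open>The supremum satisfies the equation\<close>

text \<open>A jet violating both alternatives gives a paraboloid that violates them strictly in a
  whole neighbourhood. An admissible function nearly attaining the supremum at \<open>x0\<close> has
  a contact point with a translate of this paraboloid nearby, where its own subsolution property is
  contradicted.\<close>

lemma subsol_perron: "subsol perron"
  unfolding visc_sub_iff_superjet
proof (intro conjI ballI allI impI)
  show "usc_on (closure \<Omega>) perron" by (rule continuous_on_imp_usc_on[OF continuous_on_perron])
  fix x0 p H assume x0: "x0 \<in> \<Omega> \<union> \<Gamma>N" and J: "superjet (closure \<Omega>) perron x0 p H"
  have lin: "linear H" using J by (simp add: superjet_def)
  have x0c: "x0 \<in> closure \<Omega>" using x0 closure_domain_eq by blast
  show "- inf_lap_plus p H - \<beta> * norm p \<le> f x0 \<or> x0 \<in> \<Gamma>N \<and> p \<bullet> \<nu> x0 \<le> 0"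
  proof (rule ccontr)
    assume no: "\<not> ?thesis"
    \<comment> \<open>Of the gap \<open>5 * e\<close>, the enlarged Hessian spends
      \<open>4 * e\<close>; the remaining \<open>e\<close> keeps the inequality strict.\<close>
    define e where "e = - (inf_lap_plus p H + \<beta> * norm p + f x0) / 5"
    have e: "e > 0" using no by (simp add: e_def)
    \<comment> \<open>The paraboloid gains \<open>2 * e\<close> times the squared distance: half
      absorbs the jet error, half makes the maximum at \<open>x0\<close> strict.\<close>
    define K where "K = symm H (4 * e)"
    have K: "linear K" "\<And>v w. K v \<bullet> w = v \<bullet> K w" "\<And>v. K v \<bullet> v = H v \<bullet> v + 4 * e * (norm v)\<^sup>2"
      using linear_symm[OF lin] symm_sym[OF lin] symm_form[OF lin] by (auto simp: K_def)
    have "inf_lap_plus p K \<le> inf_lap_plus p H + 4 * e"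
      by (rule inf_lap_plus_mono[OF lin]) (simp add: K(3))
    then have "inf_lap_plus p K + \<beta> * norm p + f x0 < 0" using e by (simp add: e_def field_simps)
    moreover have "p \<bullet> \<nu> x0 > 0" if "x0 \<in> \<Gamma>N" using no that by simp
    ultimately obtain s where s: "s > 0" and strict: "\<And>x. x \<in> closure \<Omega> \<inter> ball x0 s \<Longrightarrow> x \<in> \<Omega> \<union> \<Gamma>N \<and>
       inf_lap_plus (p + K (x - x0)) K + \<beta> * norm (p + K (x - x0)) + f x < 0 \<and>
       (x \<in> \<Gamma>N \<longrightarrow> (p + K (x - x0)) \<bullet> \<nu> x > 0)"
      using strict_jet_nbhd[OF x0 K(1) continuous_f] by blast
    obtain r where r: "r > 0" "\<forall>y\<in>closure \<Omega> \<inter> ball x0 r. perron y \<le> perron x0 + p \<bullet> (y - x0)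
        + H (y - x0) \<bullet> (y - x0) / 2 + e * (norm (y - x0))\<^sup>2"
      using J e unfolding superjet_def by meson
    define t where "t = min r s / 2"
    have t: "0 < t" "t < r" "t < s" using r(1) s by (auto simp: t_def min_def)
    define q where "q y = p \<bullet> (y - x0) + K (y - x0) \<bullet> (y - x0) / 2" for y
    have above: "perron y - q y \<le> perron x0 - e * (norm (y - x0))\<^sup>2"
      if "y \<in> closure \<Omega> \<inter> ball x0 r" for y
      using r(2)[rule_format, OF that] by (simp add: q_def K(3) field_simps)
    \<comment> \<open>The tolerance is the drop of \<open>perron - q\<close> at radius
      \<open>t\<close>, which forces the maximum over the closed ball off its sphere.\<close>
    have "\<exists>u. admissible u \<and> perron x0 - e * t\<^sup>2 < u x0"
    proof (rule ccontr)
      assume "\<not> ?thesis"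
      then have "perron x0 \<le> perron x0 - e * t\<^sup>2" by (intro perron_least) (auto simp: not_less)
      then show False using e t by (simp add: mult_le_0_iff)
    qed
    then obtain u where u: "admissible u" "perron x0 - e * t\<^sup>2 < u x0" by blast
    have su: "subsol u" using u(1) by (simp add: admissible_def)
    have contq: "continuous_on T q" for T unfolding q_def
      by (intro continuous_on_add continuous_on_divide continuous_on_inner continuous_on_diff
          continuous_on_const continuous_on_id continuous_on_linear_shift K(1)) auto
    have "usc_on (closure \<Omega> \<inter> cball x0 t) (\<lambda>x. u x - q x)"
    proof (rule usc_on_minus_continuous[OF _ contq])
      have "usc_on (closure \<Omega>) u" using su by (simp add: visc_sub_def)
      then show "usc_on (closure \<Omega> \<inter> cball x0 t) u" by (rule usc_on_subset) simp
    qed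
    moreover have "compact (closure \<Omega> \<inter> cball x0 t)" using compact_closure_domain by (simp add: compact_Int_closed)
    moreover have x0t: "x0 \<in> closure \<Omega> \<inter> cball x0 t" using x0c t by simp
    ultimately obtain m where m: "m \<in> closure \<Omega> \<inter> cball x0 t"
      and mx: "\<And>y. y \<in> closure \<Omega> \<inter> cball x0 t \<Longrightarrow> u y - q y \<le> u m - q m"
      using usc_on_attains_max[of "closure \<Omega> \<inter> cball x0 t"] by (metis (no_types, lifting) empty_iff)
    have mr: "m \<in> closure \<Omega> \<inter> ball x0 r" using m t by auto
    have "perron x0 - e * t\<^sup>2 < u x0 - q x0" using u(2) by (simp add: q_def linear_0[OF K(1)])
    also have "\<dots> \<le> u m - q m" by (rule mx[OF x0t])
    also have "\<dots> \<le> perron m - q m" using perron_upper[OF u(1)] m by simp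
    also have "\<dots> \<le> perron x0 - e * (norm (m - x0))\<^sup>2" by (rule above[OF mr])
    finally have "e * (norm (m - x0))\<^sup>2 < e * t\<^sup>2" by simp
    then have "(norm (m - x0))\<^sup>2 < t\<^sup>2" using e by simp
    then have nt: "norm (m - x0) < t" using t by (meson less_imp_le power2_less_imp_less)
    have "loc_max_rel (closure \<Omega>) (\<lambda>x. u x - q x) m"
      unfolding loc_max_rel_def
    proof (intro exI[of _ "t - norm (m - x0)"] conjI ballI)
      fix y assume y: "y \<in> closure \<Omega> \<inter> ball m (t - norm (m - x0))"
      have "dist x0 y \<le> dist x0 m + dist m y" by (rule dist_triangle)
      then show "u y - q y \<le> u m - q m" using y by (intro mx) (auto simp: dist_norm norm_minus_commute)
    qed (use nt in simp)
    moreover have "taylor2 q m (p + K (m - x0)) K"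
      using taylor2_quadratic[OF K(1,2), of 0 p x0 m] by (simp add: q_def[abs_def])
    ultimately have "superjet (closure \<Omega>) u m (p + K (m - x0)) K" by (rule superjet_of_loc_max)
    moreover have "m \<in> closure \<Omega> \<inter> ball x0 s" using m t by auto
    note strict[OF this]
    ultimately show False using visc_subD[OF su, of m "p + K (m - x0)" K] by auto
  qed
qed

text \<open>If the supersolution condition failed at a point, the touching paraboloid, lifted slightly, would
  be a strict subsolution nearby and could be glued into the supremum, contradicting maximality.\<close>

lemma supersol_perron: "visc_super \<Omega> \<Gamma>N \<nu> \<beta> f perron"
  unfolding visc_super_iff_visc_sub visc_sub_iff_superjet
proof (intro conjI ballI allI impI)
  show "usc_on (closure \<Omega>) (\<lambda>x. - perron x)"
    by (intro continuous_on_imp_usc_on continuous_intros continuous_on_perron)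
  fix x0 p H assume x0: "x0 \<in> \<Omega> \<union> \<Gamma>N" and J: "superjet (closure \<Omega>) (\<lambda>x. - perron x) x0 p H"
  have lin: "linear H" using J by (simp add: superjet_def)
  have x0c: "x0 \<in> closure \<Omega>" using x0 closure_domain_eq by blast
  show "- inf_lap_plus p H - - \<beta> * norm p \<le> - f x0 \<or> x0 \<in> \<Gamma>N \<and> p \<bullet> \<nu> x0 \<le> 0"
  proof (rule ccontr)
    assume no: "\<not> ?thesis"
    define e where "e = - (inf_lap_plus p H + (- \<beta>) * norm p + (- f x0)) / 5"
    have e: "e > 0" using no by (simp add: e_def)
    define K where "K = symm H (4 * e)"
    have K: "linear K" "\<And>v w. K v \<bullet> w = v \<bullet> K w" "\<And>v. K v \<bullet> v = H v \<bullet> v + 4 * e * (norm v)\<^sup>2"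
      using linear_symm[OF lin] symm_sym[OF lin] symm_form[OF lin] by (auto simp: K_def)
    have "inf_lap_plus p K \<le> inf_lap_plus p H + 4 * e"
      by (rule inf_lap_plus_mono[OF lin]) (simp add: K(3))
    then have "inf_lap_plus p K + (- \<beta>) * norm p + (- f x0) < 0" using e by (simp add: e_def field_simps)
    moreover have "p \<bullet> \<nu> x0 > 0" if "x0 \<in> \<Gamma>N" using no that by simp
    moreover have "continuous_on (\<Omega> \<union> \<Gamma>N) (\<lambda>x. - f x)" by (intro continuous_intros continuous_f)
    ultimately obtain s where s: "s > 0" and strict: "\<And>x. x \<in> closure \<Omega> \<inter> ball x0 s \<Longrightarrow> x \<in> \<Omega> \<union> \<Gamma>N \<and>
       inf_lap_plus (p + K (x - x0)) K + (- \<beta>) * norm (p + K (x - x0)) + (- f x) < 0 \<and>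
       (x \<in> \<Gamma>N \<longrightarrow> (p + K (x - x0)) \<bullet> \<nu> x > 0)"
      using strict_jet_nbhd[OF x0 K(1), of "\<lambda>x. - f x" p "- \<beta>"] by blast
    obtain r where r: "r > 0" "\<forall>y\<in>closure \<Omega> \<inter> ball x0 r. - perron y \<le> - perron x0 + p \<bullet> (y - x0)
        + H (y - x0) \<bullet> (y - x0) / 2 + e * (norm (y - x0))\<^sup>2"
      using J e unfolding superjet_def by meson
    define t where "t = min r s / 2"
    have t: "0 < t" "t < r" "t < s" using r(1) s by (auto simp: t_def min_def)
    \<comment> \<open>The lift is the gap between paraboloid and supremum at radius
      \<open>t / 2\<close>: the lifted paraboloid drops below \<open>perron\<close> beyond that
      radius, well before the gluing ends at \<open>t\<close>.\<close>
    define \<delta> where "\<delta> = e * (t / 2)\<^sup>2"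
    have \<delta>: "\<delta> > 0" using e t by (simp add: \<delta>_def)
    define q where "q y = 0 + p \<bullet> (y - x0) + K (y - x0) \<bullet> (y - x0) / 2" for y
    define \<psi> where "\<psi> y = (perron x0 + \<delta>) - q y" for y
    have below: "\<psi> y < perron y" if y: "y \<in> closure \<Omega>" "norm (y - x0) < r" "t / 2 < norm (y - x0)" for y
    proof -
      have "y \<in> closure \<Omega> \<inter> ball x0 r" using y by (simp add: dist_norm norm_minus_commute)
      from r(2)[rule_format, OF this]
      have "\<psi> y + e * (norm (y - x0))\<^sup>2 \<le> perron y + \<delta>"
        by (simp add: \<psi>_def q_def K(3) field_simps)
      moreover have "(t / 2)\<^sup>2 < (norm (y - x0))\<^sup>2" using y(3) t by (intro power_strict_mono) auto
      then have "\<delta> < e * (norm (y - x0))\<^sup>2" using e by (simp add: \<delta>_def)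
      ultimately show ?thesis by linarith
    qed
    define W where "W y = (if y \<in> ball x0 t then max (perron y) (\<psi> y) else perron y)" for y
    have W_ge: "perron y \<le> W y" for y by (simp add: W_def)
    have W_far: "W y = perron y" if "y \<in> closure \<Omega>" "t / 2 < norm (y - x0)" for y
    proof (cases "y \<in> ball x0 t")
      case True
      then have "norm (y - x0) < r" using t by (simp add: dist_norm norm_minus_commute)
      from below[OF that(1) this that(2)] show ?thesis by (simp add: W_def)
    qed (simp only: W_def if_False)
    have cont\<psi>: "continuous_on T \<psi>" for T unfolding \<psi>_def q_def
      by (intro continuous_on_add continuous_on_divide continuous_on_inner continuous_on_diff
          continuous_on_const continuous_on_id continuous_on_linear_shift K(1)) auto
    have "admissible W"
      unfolding admissible_def
    proof (intro conjI ballI)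
      fix x assume x: "x \<in> \<Gamma>D"
      \<comment> \<open>The gluing ball avoids the Dirichlet boundary, since \<open>strict\<close>
        places all nearby points of the closure in
        \<open>\<Omega> \<union> \<Gamma>N\<close>.\<close>
      have "x \<notin> ball x0 t"
      proof
        assume "x \<in> ball x0 t"
        then have "x \<in> closure \<Omega> \<inter> ball x0 s" using x t closure_domain_eq by auto
        then show False using strict x frontier_eq by blast
      qed
      then show "W x \<le> g x" using perron_boundary[OF x] by (simp only: W_def if_False)
    next
      show "subsol W" unfolding visc_sub_iff_superjet
      proof (intro conjI ballI allI impI)
        have "usc_on (closure \<Omega>) (\<lambda>y. max (perron y) (\<psi> y))"
          by (intro continuous_on_imp_usc_on continuous_intros continuous_on_perron cont\<psi>)
        moreover have "usc_on (closure \<Omega>) perron" by (rule continuous_on_imp_usc_on[OF continuous_on_perron])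
        ultimately show "usc_on (closure \<Omega>) W"
          unfolding usc_on_def
        proof (intro ballI allI impI)
          fix x and \<epsilon> :: real
          assume U1: "\<forall>x\<in>closure \<Omega>. \<forall>e>0. \<exists>d>0. \<forall>y\<in>closure \<Omega>. dist y x < d \<longrightarrow> max (perron y) (\<psi> y) < max (perron x) (\<psi> x) + e"
            and U2: "\<forall>x\<in>closure \<Omega>. \<forall>e>0. \<exists>d>0. \<forall>y\<in>closure \<Omega>. dist y x < d \<longrightarrow> perron y < perron x + e"
            and x: "x \<in> closure \<Omega>" and \<epsilon>: "\<epsilon> > 0"
          show "\<exists>d>0. \<forall>y\<in>closure \<Omega>. dist y x < d \<longrightarrow> W y < W x + \<epsilon>"
          proof (cases "x \<in> ball x0 t")
            case True
            obtain d where d: "d > 0" "\<forall>y\<in>closure \<Omega>. dist y x < d \<longrightarrow> max (perron y) (\<psi> y) < max (perron x) (\<psi> x) + \<epsilon>"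
              using U1 x \<epsilon> by blast
            have "W y \<le> max (perron y) (\<psi> y)" for y by (simp add: W_def)
            then have "\<forall>y\<in>closure \<Omega>. dist y x < d \<longrightarrow> W y < W x + \<epsilon>"
              using d(2) True by (metis W_def le_less_trans)
            then show ?thesis using d(1) by blast
          next
            case False
            \<comment> \<open>On the sphere and outside it, the points within \<open>t / 2\<close>
              still lie in the region where \<open>W\<close> and \<open>perron\<close> agree, so the
              case distinction causes no jump.\<close>
            then have nx: "t \<le> norm (x - x0)" by (simp add: dist_norm norm_minus_commute)
            obtain d where d: "d > 0" "\<forall>y\<in>closure \<Omega>. dist y x < d \<longrightarrow> perron y < perron x + \<epsilon>"
              using U2 x \<epsilon> by blast
            have "W y < W x + \<epsilon>" if y: "y \<in> closure \<Omega>" "dist y x < min d (t / 2)" for y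
            proof -
              have "norm (x - x0) \<le> norm (y - x0) + dist y x"
                using norm_triangle_sub[of "x - x0" "y - x0"] by (simp add: dist_norm norm_minus_commute)
              then have "t / 2 < norm (y - x0)" using y nx by simp
              then have "W y = perron y" by (rule W_far[OF y(1)])
              then show ?thesis using d(2) y W_ge[of x] by force
            qed
            then show ?thesis using d(1) t by (intro exI[of _ "min d (t / 2)"]) auto
          qed
        qed
        fix x p' K' assume x: "x \<in> \<Omega> \<union> \<Gamma>N" and JW: "superjet (closure \<Omega>) W x p' K'"
        show "- inf_lap_plus p' K' - \<beta> * norm p' \<le> f x \<or> x \<in> \<Gamma>N \<and> p' \<bullet> \<nu> x \<le> 0"
        proof (cases "W x = perron x")
          case True
          have "superjet (closure \<Omega>) perron x p' K'"
            by (rule superjet_antimono[OF JW True zero_less_one W_ge])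
          then show ?thesis by (rule visc_subD[OF subsol_perron x])
        next
          case False
          then have xt: "x \<in> ball x0 t" and W\<psi>: "W x = \<psi> x" by (auto simp: W_def max_def split: if_splits)
          obtain \<rho> where \<rho>: "\<rho> > 0" "ball x \<rho> \<subseteq> ball x0 t" using xt open_contains_ball[of "ball x0 t"] by blast
          have J\<psi>: "superjet (closure \<Omega>) \<psi> x p' K'"
            using \<rho>(2) by (intro superjet_antimono[where u = \<psi>, OF JW W\<psi> \<rho>(1)]) (auto simp: W_def subset_iff)
          have linK': "linear K'" using JW by (simp add: superjet_def)
          define P where "P = p + K (x - x0)"
          have "taylor2 q x P K"
            using taylor2_quadratic[OF K(1,2), of 0 p x0 x] by (simp add: q_def[abs_def] P_def)
          then have T: "taylor2 \<psi> x (- P) (\<lambda>v. - K v)"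
            using taylor2_uminus[of q x P K "perron x0 + \<delta>"] by (simp add: \<psi>_def[abs_def])
          have "x \<in> closure \<Omega> \<inter> ball x0 s" using x xt t closure_domain_eq by auto
          note st = strict[OF this, folded P_def]
          show ?thesis
          proof (cases "x \<in> \<Gamma>N")
            case True
            then have "p' \<bullet> \<nu> x \<le> - P \<bullet> \<nu> x" using superjet_normal[OF _ T J\<psi>] by blast
            then show ?thesis using st True by auto
          next
            case False
            then have "x \<in> interior (closure \<Omega>)"
              using x open_domain interior_maximal[OF closure_subset open_domain] by blast
            note I = superjet_taylor2_interior[OF T J\<psi> this]
            \<comment> \<open>The strict inequality concerns the upper infinity Laplacian of
              \<open>K\<close>, the goal that of a jet above \<open>- K\<close>; ellipticity and the
              order between lower and upper infinity Laplacian link them.\<close>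
            have "inf_lap_plus (- P) (\<lambda>v. - K v) \<le> inf_lap_plus (- P) K' + 0"
              using I(2) by (intro inf_lap_plus_mono[OF linK']) simp
            then have "- inf_lap_plus (- P) K' \<le> inf_lap_plus P K"
              using inf_lap_minus_le_plus[OF K(1), of P] by linarith
            then show ?thesis using st by (simp add: I(1))
          qed
        qed
      qed
    qed
    then have "W x0 \<le> perron x0" using x0c by (rule perron_upper)
    moreover have "W x0 \<ge> \<psi> x0" using t by (simp add: W_def)
    ultimately show False using \<delta> by (simp add: \<psi>_def q_def linear_0[OF K(1)])
  qed
qed

lemma greatest_solution:
  "\<exists>uh. visc_sol_bvp \<Omega> \<Gamma>N \<Gamma>D \<nu> \<beta> f g uh \<and>
     (\<forall>u. visc_sub \<Omega> \<Gamma>N \<nu> \<beta> f u \<and> (\<forall>x\<in>\<Gamma>D. u x \<le> g x) \<longrightarrow> (\<forall>x\<in>closure \<Omega>. u x \<le> uh x))"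
proof (intro exI[of _ perron] conjI)
  show "visc_sol_bvp \<Omega> \<Gamma>N \<Gamma>D \<nu> \<beta> f g perron"
    unfolding visc_sol_bvp_def
    using continuous_on_perron subsol_perron supersol_perron perron_boundary by blast
qed (use perron_upper in \<open>auto simp: admissible_def\<close>)

end

section \<open>Both extremal solutions by reflection\<close>

lemma visc_sol_bvp_uminus:
  assumes "visc_sol_bvp \<Omega> \<Gamma> \<Gamma>' \<nu> (- \<beta>) (\<lambda>x. - f x) (\<lambda>x. - g x) u"
  shows "visc_sol_bvp \<Omega> \<Gamma> \<Gamma>' \<nu> \<beta> f g (\<lambda>x. - u x)"
  using assms visc_super_iff_visc_sub[of \<Omega> \<Gamma> \<nu> \<beta> f "\<lambda>x. - u x"]
    visc_super_iff_visc_sub[of \<Omega> \<Gamma> \<nu> "- \<beta>" "\<lambda>x. - f x" u]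
  by (auto simp: visc_sol_bvp_def intro!: continuous_intros)

theorem theorem2p4:
  fixes \<Omega> A :: "'a::euclidean_space set" and \<nu> :: "'a \<Rightarrow> 'a" and \<beta> :: real
    and f g :: "'a \<Rightarrow> real"
  defines "\<Gamma>N \<equiv> frontier \<Omega> \<inter> A" and "\<Gamma>D \<equiv> frontier \<Omega> - A"
  assumes "bounded \<Omega>" and "open \<Omega>" and "connected \<Omega>"
    and "C1_domain_normal \<Omega> \<nu>"
    and "open A" and "\<Gamma>D \<noteq> {}" and "\<Gamma>N \<noteq> {} \<Longrightarrow> convex \<Omega>"
    and "continuous_on (\<Omega> \<union> \<Gamma>N) f" and "bounded (f ` (\<Omega> \<union> \<Gamma>N))"
    and "continuous_on \<Gamma>D g"
  shows "\<exists>ul uh. visc_sol_bvp \<Omega> \<Gamma>N \<Gamma>D \<nu> \<beta> f g ul \<and> visc_sol_bvp \<Omega> \<Gamma>N \<Gamma>D \<nu> \<beta> f g uh \<and>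
     (\<forall>u. visc_sub \<Omega> \<Gamma>N \<nu> \<beta> f u \<and> (\<forall>x\<in>\<Gamma>D. u x \<le> g x) \<longrightarrow> (\<forall>x\<in>closure \<Omega>. u x \<le> uh x)) \<and>
     (\<forall>u. visc_super \<Omega> \<Gamma>N \<nu> \<beta> f u \<and> (\<forall>x\<in>\<Gamma>D. u x \<ge> g x) \<longrightarrow> (\<forall>x\<in>closure \<Omega>. ul x \<le> u x))"
proof -
  obtain M where M: "\<And>x. x \<in> \<Omega> \<union> \<Gamma>N \<Longrightarrow> \<bar>f x\<bar> \<le> M"
    using assms(11) unfolding bounded_iff by auto
  have "mixed_domain \<Omega> A \<nu>"
    using assms(3-9) convex_imp_oblique[OF assms(4,6)]
    unfolding mixed_domain_def \<Gamma>N_def \<Gamma>D_def by blast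
  \<comment> \<open>The bound \<open>M + 1\<close> is strict, and it depends only on |f|, so it
    serves the original and the reflected data alike.\<close>
  then have dom: "mixed_problem \<Omega> A \<nu> (M + 1) f' g'"
    if "continuous_on (\<Omega> \<union> \<Gamma>N) f'" "\<And>x. \<bar>f' x\<bar> = \<bar>f x\<bar>" "continuous_on \<Gamma>D g'" for f' g'
    unfolding mixed_problem_def mixed_problem_axioms_def
    using that M unfolding \<Gamma>N_def \<Gamma>D_def by force
  interpret P: mixed_problem \<Omega> A \<nu> \<beta> "M + 1" f g
    by (rule dom) (use assms in auto)
  interpret N: mixed_problem \<Omega> A \<nu> "- \<beta>" "M + 1" "\<lambda>x. - f x" "\<lambda>x. - g x"
    by (rule dom) (use assms in \<open>auto intro!: continuous_intros\<close>)
  obtain uh where uh: "visc_sol_bvp \<Omega> \<Gamma>N \<Gamma>D \<nu> \<beta> f g uh"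
    "\<And>u. visc_sub \<Omega> \<Gamma>N \<nu> \<beta> f u \<and> (\<forall>x\<in>\<Gamma>D. u x \<le> g x) \<Longrightarrow> \<forall>x\<in>closure \<Omega>. u x \<le> uh x"
    using P.greatest_solution unfolding \<Gamma>N_def \<Gamma>D_def by blast
  obtain w where w: "visc_sol_bvp \<Omega> \<Gamma>N \<Gamma>D \<nu> (- \<beta>) (\<lambda>x. - f x) (\<lambda>x. - g x) w"
    "\<And>u. visc_sub \<Omega> \<Gamma>N \<nu> (- \<beta>) (\<lambda>x. - f x) u \<and> (\<forall>x\<in>\<Gamma>D. u x \<le> - g x) \<Longrightarrow> \<forall>x\<in>closure \<Omega>. u x \<le> w x"
    using N.greatest_solution unfolding \<Gamma>N_def \<Gamma>D_def by blast
  have "\<forall>x\<in>closure \<Omega>. - w x \<le> u x"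
    if "visc_super \<Omega> \<Gamma>N \<nu> \<beta> f u" "\<forall>x\<in>\<Gamma>D. u x \<ge> g x" for u
    using w(2)[of "\<lambda>x. - u x"] that unfolding visc_super_iff_visc_sub by force
  then show ?thesis
    using uh visc_sol_bvp_uminus[OF w(1)]
    by (intro exI[of _ "\<lambda>x. - w x"] exI[of _ uh]) blast
qed

end
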